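(* Let $\alpha$ and $\beta$ be countable ordinals with $\beta>0$, let $k$ be a positive integer, and suppose that for every coloring $c:\left[\omega^{\omega^\alpha}\right]^2\to\{\text{red},\text{blue}\}$ at least one of the following holds: \begin{itemize} \item there is a blue-homogeneous set of $k+2$ points, or \item there is a red-homogeneous closed copy of $\omega^\beta$ that is cofinal in $\omega^{\omega^\alpha}$, or \item there is a red-homogeneous closed copy of $\omega^\beta+1$. \end{itemize} Then \[\omega^{\omega^\alpha\cdot(k+1)}+1\to_{cl}(\omega^\beta+1,k+2)^2.\] Moreover, if $\omega^{\omega^\alpha}>\omega^\beta$, then in fact \[\omega^{\omega^\alpha\cdot k}+1\to_{cl}(\omega^\beta+1,k+2)^2.\]
   Context: All arithmetic operations on ordinals are in the ordinal sense. Every ordinal is identified with the set of smaller ordinals and carries the order topology; subsets carry the subspace topology. A set $X$ of ordinals is order-homeomorphic to an ordinal $\mu$, also called a closed copy of $\mu$, if there is a bijection $X\to\mu$ that is both an order-isomorphism and a homeomorphism; equivalently, $X$ is order-isomorphic to $\mu$ and closed in its supremum. $[X]^2$ is the set of $2$-element subsets of $X$. Given a coloring $c:[\delta]^2\to\{\text{red},\text{blue}\}$, a set $X\subseteq\delta$ is red-homogeneous (blue-homogeneous) if all elements of $[X]^2$ are red (blue). $\delta\to_{cl}(\mu,k)^2$ means: for every coloring $c:[\delta]^2\to\{\text{red},\text{blue}\}$ there is either a red-homogeneous closed copy of $\mu$ contained in $\delta$ or a blue-homogeneous subset of $\delta$ with $k$ elements. *)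

theory Defs
  imports "HOL-Analysis.Analysis" "HOL-Library.Ramsey"
begin

text \<open>A countable ordinal is the order type of a well-order of a set of natural numbers
  (\<^term>\<open>ordIso\<close> relates well-orders only, hence \<^verbatim>\<open>partial\<close>).
  The type is the ordinal $\omega_1$: see \<open>countable_lessThan_cordinal\<close> and
  \<open>countable_strict_bound\<close> below.\<close>

quotient_type cordinal = "nat rel" / partial: "\<lambda>r s. (r, s) \<in> ordIso"
proof (rule part_equivpI)
  show "\<exists>r::nat rel. (r, r) \<in> ordIso"
    by (rule exI[of _ "{}"]) (simp add: ordIso_reflexive)
  show "symp (\<lambda>(r::nat rel) s. (r, s) \<in> ordIso)"
    by (auto intro: sympI ordIso_symmetric)
  show "transp (\<lambda>(r::nat rel) s. (r, s) \<in> ordIso)"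
    by (auto intro: transpI ordIso_transitive)
qed

lemma ordIso_Well_order: "(r, s) \<in> ordIso \<Longrightarrow> Well_order r"
  by (simp add: ordIso_def)

instantiation cordinal :: linorder
begin

lift_definition less_eq_cordinal :: "cordinal \<Rightarrow> cordinal \<Rightarrow> bool"
  is "\<lambda>r s. (r, s) \<in> ordLeq"
  by (meson ordIso_ordLeq_trans ordIso_symmetric ordLeq_ordIso_trans)

lift_definition less_cordinal :: "cordinal \<Rightarrow> cordinal \<Rightarrow> bool"
  is "\<lambda>r s. (r, s) \<in> ordLess"
  by (meson ordIso_ordLess_trans ordIso_symmetric ordLess_ordIso_trans)

instance
proof
  fix x y z :: cordinal
  show "x < y \<longleftrightarrow> x \<le> y \<and> \<not> y \<le> x"
    by transfer (meson ordIso_Well_order not_ordLeq_iff_ordLess ordLess_imp_ordLeq)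
  show "x \<le> x"
    by transfer (simp add: ordIso_iff_ordLeq)
  show "x \<le> y \<Longrightarrow> y \<le> z \<Longrightarrow> x \<le> z"
    by transfer (rule ordLeq_transitive)
  show "x \<le> y \<Longrightarrow> y \<le> x \<Longrightarrow> x = y"
    by transfer (simp add: ordIso_iff_ordLeq)
  show "x \<le> y \<or> y \<le> x"
    by transfer (meson ordIso_Well_order ordLeq_total)
qed

end

lemma well_order_rep: "Well_order (rep_cordinal x)"
  using Quotient_rep_reflp[OF Quotient_cordinal, of x] by (rule ordIso_Well_order)

lemma abs_rep_cordinal: "abs_cordinal (rep_cordinal x) = x"
  by (rule Quotient_cordinal[THEN Quotient_abs_rep])

lemma less_abs_cordinal:
  "Well_order r \<Longrightarrow> Well_order s \<Longrightarrow> abs_cordinal r < abs_cordinal s \<longleftrightarrow> (r, s) \<in> ordLess"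
  by (simp add: less_cordinal.abs_eq ordIso_reflexive)

lemma le_abs_cordinal:
  "Well_order r \<Longrightarrow> Well_order s \<Longrightarrow> abs_cordinal r \<le> abs_cordinal s \<longleftrightarrow> (r, s) \<in> ordLeq"
  by (simp add: less_eq_cordinal.abs_eq ordIso_reflexive)

lemma eq_abs_cordinal:
  "Well_order r \<Longrightarrow> Well_order s \<Longrightarrow> abs_cordinal r = abs_cordinal s \<longleftrightarrow> (r, s) \<in> ordIso"
  using Quotient_rel[OF Quotient_cordinal, of r s] by (simp add: ordIso_reflexive)

instance cordinal :: wellorder
proof
  fix P :: "cordinal \<Rightarrow> bool" and a
  assume step: "\<And>x. (\<And>y. y < x \<Longrightarrow> P y) \<Longrightarrow> P x"
  have "wf {(x::cordinal, y). x < y}"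
  proof -
    have "{(x::cordinal, y). x < y} = inv_image ordLess rep_cordinal"
      by (auto simp: inv_image_def less_cordinal.rep_eq)
    then show ?thesis using wf_inv_image[OF wf_ordLess] by simp
  qed
  then show "P a"
    by (induction a rule: wf_induct_rule) (use step in auto)
qed

lemma initial_segment_iso:
  fixes r :: "nat rel"
  assumes r: "Well_order r"
  defines "g \<equiv> \<lambda>a. abs_cordinal (Restr r (underS r a))"
  shows "bij_betw g (Field r) {..<abs_cordinal r}"
    and "\<And>a b. a \<in> Field r \<Longrightarrow> b \<in> Field r \<Longrightarrow> g a \<le> g b \<longleftrightarrow> (a, b) \<in> r"
proof -
  have wo: "wo_rel r" using r by (simp add: wo_rel_def)
  have A: "antisym r" and L: "Linear_order r"
    using wo_rel.ANTISYM[OF wo] wo_rel.LIN[OF wo] by simp_all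
  have W: "Well_order (Restr r (underS r a))" for a
    using r Well_order_Restr by blast
  show le: "g a \<le> g b \<longleftrightarrow> (a, b) \<in> r" if "a \<in> Field r" "b \<in> Field r" for a b
    using underS_incl_iff[OF L that] W
      ofilter_subset_ordLeq[OF r wo_rel.underS_ofilter[OF wo] wo_rel.underS_ofilter[OF wo], of a b]
    by (simp add: g_def le_abs_cordinal)
  show "bij_betw g (Field r) {..<abs_cordinal r}"
  proof (rule bij_betwI')
    show "g a = g b \<longleftrightarrow> a = b" if "a \<in> Field r" "b \<in> Field r" for a b
      using le[OF that] le[OF that(2) that(1)] A
      by (metis antisymD order_refl)
    show "g a \<in> {..<abs_cordinal r}" if "a \<in> Field r" for a
      using that r W underS_Restr_ordLess[OF r]
      by (auto simp: g_def less_abs_cordinal)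
    show "\<exists>a\<in>Field r. y = g a" if "y \<in> {..<abs_cordinal r}" for y
    proof -
      have "(rep_cordinal y, r) \<in> ordLess"
        using that less_abs_cordinal[OF well_order_rep r, of y] by (simp add: abs_rep_cordinal)
      then obtain a where "a \<in> Field r" "(rep_cordinal y, Restr r (underS r a)) \<in> ordIso"
        using ordLess_iff_ordIso_Restr[OF r well_order_rep] by blast
      then show ?thesis
        using eq_abs_cordinal[OF well_order_rep W, of y a] by (auto simp: g_def abs_rep_cordinal)
    qed
  qed
qed

lemma countable_lessThan_cordinal: "countable {..<x::cordinal}"
proof -
  have "countable (Field (rep_cordinal x))" by (rule countableI_type)
  then show ?thesis
    by (rule countable_image[THEN back_subst[of countable]])
      (rule bij_betw_imp_surj_on[OF initial_segment_iso(1)[OF well_order_rep, of x],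
        unfolded abs_rep_cordinal])
qed

lemma uncountable_UNIV_cordinal: "uncountable (UNIV :: cordinal set)"
proof
  assume "countable (UNIV :: cordinal set)"
  then obtain f :: "cordinal \<Rightarrow> nat" where f: "inj f"
    unfolding countable_def by blast
  define W where "W = {(x::cordinal, y). x \<le> y}"
  have FW: "Field W = UNIV" by (auto simp: W_def Field_def)
  have W: "Well_order W"
  proof -
    have "W - Id = {(x, y). x < y}" by (auto simp: W_def)
    then show ?thesis
      unfolding well_order_on_def linear_order_on_def partial_order_on_def preorder_on_def
      using FW wellorder_class.wf
      by (auto simp: W_def refl_on_def trans_def antisym_def total_on_def)
  qed
  define r where "r = dir_image W f"
  have Wr: "(W, r) \<in> ordIso"
    unfolding r_def using W f by (intro dir_image_ordIso) (auto intro: inj_on_subset)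
  then have r: "Well_order r" using ordIso_Well_order ordIso_symmetric by blast
  let ?x = "abs_cordinal r"
  let ?R = "Restr W (underS W ?x)"
  have uS: "underS W ?x = {..<?x}" by (auto simp: underS_def W_def)
  have R: "Well_order ?R" using W Well_order_Restr by blast
  have FR: "Field ?R = {..<?x}"
    unfolding uS by (auto simp: Field_def W_def)
  let ?g = "\<lambda>a. abs_cordinal (Restr r (underS r a))"
  have "(a, b) \<in> r \<longleftrightarrow> (?g a, ?g b) \<in> ?R" if "a \<in> Field r" "b \<in> Field r" for a b
  proof -
    have "?g a < ?x" "?g b < ?x"
      using that initial_segment_iso(1)[OF r] by (auto simp: bij_betw_def)
    then show ?thesis
      using initial_segment_iso(2)[OF r that] unfolding uS by (simp add: W_def)
  qed
  then have "iso r ?R ?g"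
    unfolding iso_iff2 FR using initial_segment_iso(1)[OF r] by blast
  then have "(r, ?R) \<in> ordIso" using r R unfolding ordIso_def by blast
  moreover have "(?R, W) \<in> ordLess" using underS_Restr_ordLess[OF W] FW by auto
  ultimately have "(r, r) \<in> ordLess"
    using Wr ordIso_ordLess_trans ordLess_ordIso_trans by blast
  then show False using ordLess_irreflexive by blast
qed

lemma countable_strict_bound:
  fixes A :: "cordinal set"
  assumes "countable A"
  shows "\<exists>b. \<forall>a\<in>A. a < b"
proof (rule ccontr)
  assume "\<not> ?thesis"
  then have "UNIV = (\<Union>a\<in>A. insert a {..<a})" 
    by (force simp: not_less order_le_less)
  moreover have "countable (\<Union>a\<in>A. insert a {..<a})"
    using assms countable_lessThan_cordinal by auto
  ultimately show False using uncountable_UNIV_cordinal by simp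
qed

instantiation cordinal :: "{conditionally_complete_linorder, order_bot}"
begin

lift_definition bot_cordinal :: cordinal is "{}"
  by (simp add: ordIso_reflexive)

definition "inf (x::cordinal) y = min x y"
definition "sup (x::cordinal) y = max x y"
definition "Inf (A :: cordinal set) = (LEAST x. x \<in> A)"
definition "Sup (A :: cordinal set) = (LEAST b. \<forall>a\<in>A. a \<le> b)"

instance
proof
  fix x y z :: cordinal and A :: "cordinal set"
  show "inf x y \<le> x" "inf x y \<le> y" "x \<le> sup x y" "y \<le> sup x y"
    by (auto simp: inf_cordinal_def sup_cordinal_def)
  show "x \<le> y \<Longrightarrow> x \<le> z \<Longrightarrow> x \<le> inf y z" "y \<le> x \<Longrightarrow> z \<le> x \<Longrightarrow> sup y z \<le> x"
    by (auto simp: inf_cordinal_def sup_cordinal_def)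
  show "bot \<le> x"
  proof -
    have W: "Well_order ({} :: nat rel)" by simp
    have "\<not> abs_cordinal (rep_cordinal x) < abs_cordinal {}"
      using less_abs_cordinal[OF well_order_rep W] ordLess_iff_ordIso_Restr[OF W well_order_rep]
      by auto
    then show ?thesis by (simp add: abs_rep_cordinal bot_cordinal_def)
  qed
  show "x \<in> A \<Longrightarrow> Inf A \<le> x"
    by (simp add: Inf_cordinal_def Least_le)
  show "A \<noteq> {} \<Longrightarrow> (\<And>x. x \<in> A \<Longrightarrow> z \<le> x) \<Longrightarrow> z \<le> Inf A"
    unfolding Inf_cordinal_def by (rule LeastI2_ex) auto
  show "x \<in> A \<Longrightarrow> bdd_above A \<Longrightarrow> x \<le> Sup A"
    unfolding Sup_cordinal_def bdd_above_def by (rule LeastI2_ex) auto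
  show "A \<noteq> {} \<Longrightarrow> (\<And>x. x \<in> A \<Longrightarrow> x \<le> z) \<Longrightarrow> Sup A \<le> z"
    unfolding Sup_cordinal_def by (rule Least_le) auto
qed

end

definition osucc :: "cordinal \<Rightarrow> cordinal" where
  "osucc x = (LEAST y. x < y)"

lemma osucc_less: "x < osucc x"
proof -
  have "\<exists>y. x < y" using countable_strict_bound[of "{x}"] by auto
  then show ?thesis unfolding osucc_def by (rule LeastI_ex)
qed

lemma osucc_le_iff: "osucc x \<le> y \<longleftrightarrow> x < y"
proof
  show "osucc x \<le> y \<Longrightarrow> x < y" by (rule less_le_trans[OF osucc_less])
  show "x < y \<Longrightarrow> osucc x \<le> y" unfolding osucc_def by (rule Least_le)
qed

lemma less_osucc_iff: "x < osucc y \<longleftrightarrow> x \<le> y"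
  using osucc_le_iff[of y x] by (meson not_le)

lemma osucc_inject [simp]: "osucc x = osucc y \<longleftrightarrow> x = y"
proof
  assume "osucc x = osucc y"
  then have "x < osucc y" "y < osucc x" using osucc_less[of x] osucc_less[of y] by simp_all
  then show "x = y" unfolding less_osucc_iff by (rule order_antisym)
qed simp

instantiation cordinal :: "{zero, one, plus, times}"
begin

definition "(0::cordinal) = bot"
definition "(1::cordinal) = osucc 0"

function ordrec :: "cordinal \<Rightarrow> (cordinal \<Rightarrow> cordinal) \<Rightarrow> cordinal \<Rightarrow> cordinal" where
  "ordrec z s b =
    (if b = 0 then z
     else if \<exists>c. b = osucc c then s (ordrec z s (THE c. b = osucc c))
     else (SUP c\<in>{..<b}. ordrec z s c))"
  by auto
termination
proof (relation "inv_image {(x, y). x < y} (\<lambda>(z, s, b). b)")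
  show "wf (inv_image {(x::cordinal, y). x < y}
      (\<lambda>(z::cordinal, s::cordinal \<Rightarrow> cordinal, b). b))"
    by (intro wf_inv_image wellorder_class.wf)
qed (auto simp: osucc_less)

declare ordrec.simps [simp del]

definition "a + b = ordrec a osucc b" for a b :: cordinal
definition "a * b = ordrec 0 (\<lambda>x. x + a) b" for a b :: cordinal

instance ..

end

definition oexp :: "cordinal \<Rightarrow> cordinal \<Rightarrow> cordinal"  (infixr \<open>\<up>\<close> 80) where
  "a \<up> b = (if a = 0 then (if b = 0 then 1 else 0) else ordrec 1 (\<lambda>x. x * a) b)"

definition limit_ord :: "cordinal \<Rightarrow> bool" where
  "limit_ord b \<longleftrightarrow> b \<noteq> 0 \<and> (\<nexists>c. b = osucc c)"

primrec ord_of_nat :: "nat \<Rightarrow> cordinal" where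
  "ord_of_nat 0 = 0"
| "ord_of_nat (Suc n) = osucc (ord_of_nat n)"

definition omega :: cordinal  (\<open>\<omega>\<close>) where
  "\<omega> = (SUP n. ord_of_nat n)"

lemma zero_le_cordinal [simp]: "(0::cordinal) \<le> x"
  by (simp add: zero_cordinal_def)

lemma osucc_neq_0 [simp]: "osucc x \<noteq> 0"
  using le_less_trans[OF zero_le_cordinal osucc_less, of x] by simp

lemma ordrec_0: "ordrec z s 0 = z"
  by (simp add: ordrec.simps)

lemma ordrec_osucc: "ordrec z s (osucc b) = s (ordrec z s b)"
  by (subst ordrec.simps) simp

lemma ordrec_limit: "limit_ord b \<Longrightarrow> ordrec z s b = (SUP c\<in>{..<b}. ordrec z s c)"
  by (subst ordrec.simps) (simp add: limit_ord_def)

text \<open>The limit clause of \<^term>\<open>ordrec\<close> only takes suprema of bounded sets, by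
  \<open>bdd_above_image_lessThan\<close>; an unbounded \<^term>\<open>Sup\<close> would be unspecified.\<close>

lemma bdd_above_countable: "countable A \<Longrightarrow> bdd_above (A :: cordinal set)"
  using countable_strict_bound[of A] unfolding bdd_above_def by (meson less_imp_le)

lemma bdd_above_image_lessThan: "bdd_above ((f :: cordinal \<Rightarrow> cordinal) ` {..<b})"
  by (simp add: bdd_above_countable countable_lessThan_cordinal)

lemma add_0_cordinal: "a + 0 = (a::cordinal)"
  by (simp add: plus_cordinal_def ordrec_0)

lemma add_osucc: "a + osucc b = osucc (a + b)"
  by (simp add: plus_cordinal_def ordrec_osucc)

lemma add_limit: "limit_ord b \<Longrightarrow> a + b = (SUP c\<in>{..<b}. a + c)"
  by (simp add: plus_cordinal_def ordrec_limit)

lemma add_1_cordinal: "a + 1 = osucc a"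
  by (simp add: one_cordinal_def add_osucc add_0_cordinal)

lemma mult_0_cordinal: "a * 0 = (0::cordinal)"
  by (simp add: times_cordinal_def ordrec_0)

lemma mult_osucc: "a * osucc b = a * b + a"
  by (simp add: times_cordinal_def ordrec_osucc)

lemma mult_limit: "limit_ord b \<Longrightarrow> a * b = (SUP c\<in>{..<b}. a * c)"
  by (simp add: times_cordinal_def ordrec_limit)

lemma oexp_0: "a \<up> 0 = 1"
  by (simp add: oexp_def ordrec_0)

lemma oexp_osucc: "a \<up> osucc b = a \<up> b * a"
  by (simp add: oexp_def ordrec_osucc mult_0_cordinal)

lemma oexp_limit: "limit_ord b \<Longrightarrow> a \<noteq> 0 \<Longrightarrow> a \<up> b = (SUP c\<in>{..<b}. a \<up> c)"
  by (simp add: oexp_def ordrec_limit)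

lemma ord_of_nat_less_omega: "ord_of_nat n < \<omega>"
proof -
  have "bdd_above (range ord_of_nat)" by (simp add: bdd_above_countable)
  then have "ord_of_nat (Suc n) \<le> \<omega>" unfolding omega_def by (rule cSUP_upper[OF UNIV_I])
  then show ?thesis by (simp add: osucc_le_iff)
qed

lemma less_omega_iff: "x < \<omega> \<longleftrightarrow> (\<exists>n. x = ord_of_nat n)"
proof
  have below: "x \<le> ord_of_nat n \<Longrightarrow> \<exists>m. x = ord_of_nat m" for n
  proof (induction n)
    case 0
    then show ?case by (metis ord_of_nat.simps(1) order_antisym zero_le_cordinal)
  next
    case (Suc n)
    then show ?case by (metis le_less less_osucc_iff ord_of_nat.simps(2))
  qed
  assume "x < \<omega>"
  then have "\<exists>n. x < ord_of_nat n"
    unfolding omega_def by (subst (asm) less_cSUP_iff) (auto simp: bdd_above_countable)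
  then show "\<exists>n. x = ord_of_nat n" using below less_imp_le by blast
qed (auto simp: ord_of_nat_less_omega)

instantiation cordinal :: linorder_topology
begin

definition open_cordinal :: "cordinal set \<Rightarrow> bool" where
  "open_cordinal = generate_topology (range (\<lambda>a. {..<a}) \<union> range (\<lambda>a. {a<..}))"

instance by standard (rule open_cordinal_def)

end

text \<open>An ordinal $\delta$, identified with the set of smaller ordinals, is \<^term>\<open>{..<\<delta>}\<close>. Its
  order topology is the subspace topology inherited from $\omega_1$, so all subspace topologies
  may be taken in the latter.\<close>

lemma order_topology_lessThan:
  fixes \<delta> :: cordinal
  shows "top_of_set {..<\<delta>} = topology_generated_by
    (insert {..<\<delta>} ((\<lambda>a. {..<a}) ` {..<\<delta>} \<union> (\<lambda>a. {a<..<\<delta>}) ` {..<\<delta>}))"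
    (is "_ = topology_generated_by ?B")
proof (rule topology_eq[THEN iffD2], intro allI iffI)
  fix U
  assume "openin (top_of_set {..<\<delta>}) U"
  then obtain T where "open T" and U: "U = {..<\<delta>} \<inter> T" by (auto simp: openin_open)
  have whole: "openin (topology_generated_by ?B) {..<\<delta>}"
    by (rule topology_generated_by_Basis) simp
  have "generate_topology (range (\<lambda>a. {..<a}) \<union> range (\<lambda>a. {a<..})) T"
    using \<open>open T\<close> by (simp add: open_cordinal_def)
  then have "openin (topology_generated_by ?B) ({..<\<delta>} \<inter> T)"
  proof induction
    case UNIV
    then show ?case using whole by simp
  next
    case (Int a b)
    moreover have "{..<\<delta>} \<inter> (a \<inter> b) = ({..<\<delta>} \<inter> a) \<inter> ({..<\<delta>} \<inter> b)" by blast
    ultimately show ?case by (simp only: openin_Int)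
  next
    case (UN K)
    then have "openin (topology_generated_by ?B) (\<Union>k\<in>K. {..<\<delta>} \<inter> k)" by blast
    moreover have "{..<\<delta>} \<inter> \<Union>K = (\<Union>k\<in>K. {..<\<delta>} \<inter> k)" by blast
    ultimately show ?case by (simp only:)
  next
    case (Basis s)
    then consider a where "s = {..<a}" | a where "s = {a<..}" by auto
    then show ?case
    proof cases
      case (1 a)
      show ?thesis
      proof (cases "a < \<delta>")
        case True
        then have "{..<\<delta>} \<inter> s = {..<a}" using 1 by auto
        moreover have "{..<a} \<in> ?B" using True by auto
        ultimately show ?thesis by (simp only: topology_generated_by_Basis)
      next
        case False
        then have "{..<\<delta>} \<inter> s = {..<\<delta>}" using 1 by auto
        then show ?thesis using whole by simp
      qed
    next
      case (2 a)
      have eq: "{..<\<delta>} \<inter> s = {a<..<\<delta>}" using 2 by auto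
      show ?thesis
      proof (cases "a < \<delta>")
        case True
        then have "{a<..<\<delta>} \<in> ?B" by auto
        then show ?thesis unfolding eq by (rule topology_generated_by_Basis)
      next
        case False
        then have "{..<\<delta>} \<inter> s = {}" using eq by auto
        then show ?thesis by simp
      qed
    qed
  qed
  then show "openin (topology_generated_by ?B) U" using U by simp
next
  fix U
  assume "openin (topology_generated_by ?B) U"
  then have "generate_topology_on ?B U" by (rule openin_topology_generated_by)
  then show "openin (top_of_set {..<\<delta>}) U"
  proof induction
    case (Int a b)
    then show ?case by auto
  next
    case (UN K)
    then show ?case by blast
  next
    case (Basis s)
    then consider "s = {..<\<delta>}" | a where "a < \<delta>" "s = {..<a}" | a where "s = {a<..<\<delta>}" by auto
    then have "open s \<and> s \<subseteq> {..<\<delta>}" by cases auto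
    then show ?case by (simp add: open_subset)
  qed simp
qed

definition closed_copy :: "cordinal \<Rightarrow> cordinal set \<Rightarrow> bool" where
  "closed_copy \<mu> X \<longleftrightarrow> (\<exists>f g. homeomorphism X {..<\<mu>} f g \<and> strict_mono_on X f)"

definition cofinal_in :: "cordinal set \<Rightarrow> cordinal \<Rightarrow> bool" where
  "cofinal_in X \<delta> \<longleftrightarrow> X \<subseteq> {..<\<delta>} \<and> (\<forall>y<\<delta>. \<exists>x\<in>X. y \<le> x)"

datatype color = Red | Blue

text \<open>A coloring of $[\delta]^2$ is represented by a function on all sets of ordinals, of which
  only the values on \<^term>\<open>[{..<\<delta>}]\<^bsup>2\<^esup>\<close> are ever used.\<close>

definition homogeneous :: "(cordinal set \<Rightarrow> color) \<Rightarrow> color \<Rightarrow> cordinal set \<Rightarrow> bool" where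
  "homogeneous c i X \<longleftrightarrow> (\<forall>e \<in> [X]\<^bsup>2\<^esup>. c e = i)"

definition arrow_cl :: "cordinal \<Rightarrow> cordinal \<Rightarrow> nat \<Rightarrow> bool" where
  "arrow_cl \<delta> \<mu> k \<longleftrightarrow>
    (\<forall>c. (\<exists>X \<subseteq> {..<\<delta>}. closed_copy \<mu> X \<and> homogeneous c Red X) \<or>
         (\<exists>X \<in> [{..<\<delta>}]\<^bsup>k\<^esup>. homogeneous c Blue X))"

end

theory Submission
  imports Defs
begin

text \<open>
  Write $\kappa = \omega^\alpha$ and $\delta = \omega^\kappa$. The proof shows
  $\omega^{\kappa m} + 1 \to_{cl} (\omega^\beta + 1, p)^2$ by induction on $m$, raising $m$ and $p$
  by one together: from $(m, p) = (1, 2)$ for the first claim, and from $(1, 3)$ when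
  $\delta > \omega^\beta$.

  Fix a coloring of $\theta + 1$, where $\theta = \omega^{\kappa(m+1)}$, and let $B$ be the set of
  blue neighbours of the top point $\theta$. Compare $B$ and its complement by Cantor-Bendixson
  rank. If some point of $B$ has rank at least $\kappa m$ in $B$, then $B$ contains a closed copy of
  $\omega^{\kappa m} + 1$, and the induction hypothesis inside this copy gives either the red set or
  $p$ blue points, to which $\theta$ is added. Otherwise $B$ is thin: $\theta$ has rank at most
  $\kappa m$ relative to $B$. The rank relative to a union of two sets is at most the natural sum of
  the two relative ranks (\<open>cb_rank_Un_le\<close>), and $\gamma \oplus \kappa m < \kappa(m+1)$ for
  $\gamma < \kappa$ (\<open>natural_sum_less_block\<close>). Since $\theta$ has rank $\kappa(m+1)$ among all ordinals,
  it has rank at least $\kappa$ relative to the complement of $B$.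

  A point of rank at least $t > 0$ in a set is the top of a closed copy of $\omega^t + 1$ in that set
  (\<open>embed_oexp\<close>). So there is a strictly increasing continuous $f$ on $\delta + 1$ with
  $f(\delta) = \theta$ whose other values are red neighbours of $\theta$. The hypothesis of the theorem,
  applied to the coloring pulled back along $f$, finishes the argument: a red copy of $\omega^\beta$
  cofinal in $\delta$ is completed by the top point to a red copy of $\omega^\beta + 1$. Cofinality is
  what makes the completed set closed, and this is why the embedding $f$ has to reach $\theta$.

  The base cases, where $\theta = \delta$, follow the same division. For $(1, 2)$ either $B$ is empty or
  one of its points forms a blue pair with $\theta$; for $(1, 3)$ the bound $\kappa m$ is replaced by
  $\beta$.
\<close>

section \<open>Ordinal arithmetic\<close>

lemma not_less_zero [simp]: "\<not> x < (0::cordinal)"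
  by (simp add: not_less)

lemma limit_ord_osucc_less: "limit_ord b \<Longrightarrow> c < b \<Longrightarrow> osucc c < b"
  by (metis le_less limit_ord_def osucc_le_iff)

lemma ord_cases [case_names zero succ limit]:
  obtains "x = 0" | c where "x = osucc c" | "limit_ord x"
  by (auto simp: limit_ord_def)

lemma less_SUP_lessThan_iff:
  fixes f :: "cordinal \<Rightarrow> cordinal"
  assumes "limit_ord b"
  shows "x < (SUP c\<in>{..<b}. f c) \<longleftrightarrow> (\<exists>c<b. x < f c)"
proof -
  have "0 < b" using assms by (simp add: limit_ord_def less_le)
  then show ?thesis
    by (subst less_cSUP_iff) (auto simp: bdd_above_image_lessThan)
qed

text \<open>At a limit $y$ an $x < y$ is followed by $x + 1 < y$, so the value at $x$ is exceeded at
  $x + 1$ and hence by the supremum.\<close>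

lemma ord_strict_monoI:
  fixes f :: "cordinal \<Rightarrow> cordinal"
  assumes succ: "\<And>c. f c < f (osucc c)"
    and lim: "\<And>b. limit_ord b \<Longrightarrow> f b = (SUP c\<in>{..<b}. f c)"
    and "x < y"
  shows "f x < f y"
  using \<open>x < y\<close>
proof (induction y rule: less_induct)
  case (less y)
  show ?case
  proof (cases y rule: ord_cases)
    case zero
    then show ?thesis using less.prems by simp
  next
    case (succ c)
    then have "x \<le> c" using less.prems by (simp add: less_osucc_iff)
    then have "f x \<le> f c" using less.IH[of c] succ osucc_less by (auto simp: le_less)
    then show ?thesis using assms(1)[of c] succ by simp
  next
    case limit
    have "osucc x < y" by (rule limit_ord_osucc_less[OF limit less.prems])
    then show ?thesis
      unfolding lim[OF limit] less_SUP_lessThan_iff[OF limit] using assms(1) by blast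
  qed
qed

lemma ord_le_strict_mono:
  fixes f :: "cordinal \<Rightarrow> cordinal"
  assumes "\<And>x y. x < y \<Longrightarrow> f x < f y"
  shows "x \<le> f x"
proof (induction x rule: less_induct)
  case (less x)
  show ?case
  proof (rule ccontr)
    assume "\<not> x \<le> f x"
    then show False using less[of "f x"] assms[of "f x" x] by (auto simp: not_le)
  qed
qed

lemma add_strict_mono_right: "b < c \<Longrightarrow> a + b < a + (c :: cordinal)"
  by (rule ord_strict_monoI[where f = "\<lambda>x. a + x"]) (auto simp: add_osucc osucc_less add_limit)

lemma add_less_iff: "a + b < a + c \<longleftrightarrow> b < (c :: cordinal)"
  by (metis add_strict_mono_right less_asym linorder_less_linear)

lemma le_add: "a \<le> a + (b :: cordinal)"
  using add_strict_mono_right[of 0 b a]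
  by (cases "b = 0") (auto simp: add_0_cordinal less_le)

lemma exists_difference:
  fixes a c :: cordinal
  assumes "a \<le> c"
  obtains d where "c = a + d"
proof -
  have "\<exists>d. c = a + d" using assms
  proof (induction c rule: less_induct)
    case (less c)
    show ?case
    proof (cases "a = c")
      case True
      then show ?thesis using add_0_cordinal by metis
    next
      case False
      then have ac: "a < c" using less.prems by simp
      show ?thesis
      proof (cases c rule: ord_cases)
        case zero
        then show ?thesis using ac by simp
      next
        case (succ e)
        then show ?thesis using less.IH[of e] ac osucc_less less_osucc_iff add_osucc by metis
      next
        case limit
        \<comment> \<open>minimality gives $a + e < c$ for all $e < d$, so $a + d$ cannot jump over $c$\<close>
        define d where "d = (LEAST d. c \<le> a + d)"
        have "c \<le> a + c"
          by (rule ord_le_strict_mono[where f = "\<lambda>x. a + x"]) (rule add_strict_mono_right)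
        then have 1: "c \<le> a + d" unfolding d_def by (rule LeastI)
        have 2: "a + e < c" if "e < d" for e
          using not_less_Least[of e "\<lambda>d. c \<le> a + d"] that unfolding d_def by (simp add: not_le)
        have "a + d \<le> c"
        proof (cases d rule: ord_cases)
          case zero
          then show ?thesis using ac by (simp add: add_0_cordinal)
        next
          case (succ e)
          then show ?thesis using 2[of e] by (simp add: add_osucc osucc_le_iff osucc_less)
        next
          case limit
          have "\<not> c < a + d"
            unfolding add_limit[OF limit] less_SUP_lessThan_iff[OF limit] using 2 less_asym by blast
          then show ?thesis by (simp add: not_less)
        qed
        then show ?thesis using 1 by auto
      qed
    qed
  qed
  then show ?thesis using that by blast
qed

lemma zero_less_ord: "0 < x \<longleftrightarrow> x \<noteq> (0::cordinal)"
  by (auto simp: less_le)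

lemma limit_ord_omega: "limit_ord \<omega>"
proof -
  have "osucc c \<noteq> \<omega>" for c
    using osucc_less[of c] less_omega_iff[of c] ord_of_nat_less_omega[of "Suc _"]
    by (metis less_irrefl ord_of_nat.simps(2))
  moreover have "\<omega> \<noteq> 0" using ord_of_nat_less_omega[of 0] by auto
  ultimately show ?thesis by (metis limit_ord_def)
qed

lemma less_mult_omega_iff: "x < a * \<omega> \<longleftrightarrow> (\<exists>n. x < a * ord_of_nat n)"
  unfolding mult_limit[OF limit_ord_omega] less_SUP_lessThan_iff[OF limit_ord_omega]
  by (auto simp: less_omega_iff)

lemma mult_ord_of_nat_Suc: "a * ord_of_nat (Suc n) = a * ord_of_nat n + a"
  by (simp add: mult_osucc)

lemma mult_nat_mono: "m \<le> n \<Longrightarrow> a * ord_of_nat m \<le> a * ord_of_nat n"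
  by (induction n rule: dec_induct) (auto simp: mult_osucc intro: order_trans le_add)

lemma zero_add_cordinal: "0 + x = (x :: cordinal)"
proof (induction x rule: less_induct)
  case (less x)
  show ?case
  proof (cases x rule: ord_cases)
    case limit
    have "0 + x = (SUP c\<in>{..<x}. c)"
      unfolding add_limit[OF limit] using less by (intro SUP_cong) auto
    also have "\<dots> = x"
    proof (rule linorder_cases)
      assume "(SUP c\<in>{..<x}. c) < x"
      then have "osucc (SUP c\<in>{..<x}. c) < x" by (rule limit_ord_osucc_less[OF limit])
      then have "(SUP c\<in>{..<x}. c) < (SUP c\<in>{..<x}. c)"
        using less_SUP_lessThan_iff[OF limit] osucc_less by blast
      then show ?thesis by simp
    next
      assume "x < (SUP c\<in>{..<x}. c)"
      then show ?thesis using less_SUP_lessThan_iff[OF limit, of x "\<lambda>c. c"] by auto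
    qed
    finally show ?thesis .
  qed (use less in \<open>auto simp: add_0_cordinal add_osucc osucc_less\<close>)
qed

lemma mult_ord_of_nat_1: "a * ord_of_nat 1 = a"
  by (simp add: mult_osucc mult_0_cordinal zero_add_cordinal)

lemma zero_less_oexp: "0 < \<omega> \<up> x"
proof (induction x rule: less_induct)
  case (less x)
  have w: "\<omega> \<noteq> 0" using limit_ord_omega by (simp add: limit_ord_def)
  show ?case
  proof (cases x rule: ord_cases)
    case zero
    then show ?thesis by (simp add: oexp_0 one_cordinal_def zero_less_ord)
  next
    case (succ c)
    then have "0 < \<omega> \<up> c" using less osucc_less by blast
    then have "0 < \<omega> \<up> c * ord_of_nat 1" by (simp only: mult_ord_of_nat_1)
    then show ?thesis unfolding succ oexp_osucc less_mult_omega_iff by blast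
  next
    case limit
    then have "0 < x" by (simp add: limit_ord_def zero_less_ord)
    moreover from this have "0 < \<omega> \<up> 0" by (rule less)
    ultimately show ?thesis
      unfolding oexp_limit[OF limit w] less_SUP_lessThan_iff[OF limit] by blast
  qed
qed

lemma mult_nat_less: "0 < a \<Longrightarrow> a * ord_of_nat n < a * ord_of_nat (Suc n)"
  using add_strict_mono_right[of 0 a] by (simp add: mult_osucc add_0_cordinal)

lemma oexp_less: "x < y \<Longrightarrow> \<omega> \<up> x < \<omega> \<up> y"
proof (rule ord_strict_monoI[where f = "\<lambda>x. \<omega> \<up> x"])
  show "\<omega> \<up> c < \<omega> \<up> osucc c" for c
  proof -
    have "\<omega> \<up> c < \<omega> \<up> c * ord_of_nat (Suc 1)"
      using mult_nat_less[OF zero_less_oexp, of c 1] by (simp only: mult_ord_of_nat_1)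
    then show ?thesis unfolding oexp_osucc less_mult_omega_iff by blast
  qed
  show "limit_ord b \<Longrightarrow> \<omega> \<up> b = (SUP c\<in>{..<b}. \<omega> \<up> c)" for b
    using limit_ord_omega by (simp add: oexp_limit limit_ord_def)
qed

lemma less_oexp_limit: "limit_ord b \<Longrightarrow> x < \<omega> \<up> b \<longleftrightarrow> (\<exists>c<b. x < \<omega> \<up> c)"
  using limit_ord_omega by (simp add: oexp_limit less_SUP_lessThan_iff limit_ord_def)

lemma less_oexp_osucc:
  assumes "x < \<omega> \<up> osucc b"
  obtains n y where "x = \<omega> \<up> b * ord_of_nat n + y" "y < \<omega> \<up> b"
proof -
  define n where "n = (LEAST n. x < \<omega> \<up> b * ord_of_nat n)"
  have ex: "\<exists>n. x < \<omega> \<up> b * ord_of_nat n"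
    using assms unfolding oexp_osucc less_mult_omega_iff .
  then have 1: "x < \<omega> \<up> b * ord_of_nat n" unfolding n_def by (rule LeastI_ex)
  then obtain m where m: "n = Suc m" by (cases n) (auto simp: mult_0_cordinal)
  then have "\<not> x < \<omega> \<up> b * ord_of_nat m"
    using not_less_Least[of m "\<lambda>n. x < \<omega> \<up> b * ord_of_nat n"] unfolding n_def by simp
  then obtain y where y: "x = \<omega> \<up> b * ord_of_nat m + y"
    using exists_difference by (meson not_le)
  moreover have "y < \<omega> \<up> b" using 1 unfolding m y mult_ord_of_nat_Suc add_less_iff .
  ultimately show ?thesis using that by blast
qed

section \<open>Cantor-Bendixson rank relative to a set\<close>

text \<open>The Cantor-Bendixson rank of \<open>x\<close> in the subspace \<open>insert x A\<close>, computed from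
  left neighbourhoods because every ordinal $x$ has the neighbourhood of all ordinals up to $x$. The
  point \<open>x\<close> need not lie in \<open>A\<close>, so that the ranks of one point relative to several sets can be
  compared. The disjunct \<open>x = 0\<close> gives rank $0$ to the point without left neighbourhoods.\<close>

function cb_rank :: "cordinal set \<Rightarrow> cordinal \<Rightarrow> cordinal" where
  "cb_rank A x = (LEAST c. \<exists>y. (y < x \<or> x = 0) \<and> (\<forall>z \<in> A \<inter> {y<..<x}. cb_rank A z < c))"
  by auto
termination
proof (relation "inv_image {(x, y). x < y} (snd :: cordinal set \<times> cordinal \<Rightarrow> cordinal)")
  show "wf (inv_image {(x, y). x < y} (snd :: cordinal set \<times> cordinal \<Rightarrow> cordinal))"
    by (intro wf_inv_image wellorder_class.wf)
qed (simp add: inv_image_def)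

declare cb_rank.simps [simp del]

lemma cb_rank_ex: "\<exists>y. (y < x \<or> x = 0) \<and> (\<forall>z \<in> A \<inter> {y<..<x}. cb_rank A z < cb_rank A x)"
proof -
  obtain b where "\<forall>c \<in> cb_rank A ` {..<x}. c < b"
    using countable_strict_bound[of "cb_rank A ` {..<x}"]
    by (auto simp: countable_lessThan_cordinal)
  then have "\<exists>y. (y < x \<or> x = 0) \<and> (\<forall>z \<in> A \<inter> {y<..<x}. cb_rank A z < b)"
    by (intro exI[of _ 0]) (auto simp: zero_less_ord)
  then show ?thesis
    by (subst (2) cb_rank.simps) (rule LeastI)
qed

lemma cb_rank_witness:
  assumes "y\<^sub>0 < x"
  obtains y where "y\<^sub>0 \<le> y" "y < x" "\<And>z. z \<in> A \<Longrightarrow> y < z \<Longrightarrow> z < x \<Longrightarrow> cb_rank A z < cb_rank A x"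
proof -
  obtain y where "y < x \<or> x = 0" "\<forall>z \<in> A \<inter> {y<..<x}. cb_rank A z < cb_rank A x"
    using cb_rank_ex by blast
  moreover have "x \<noteq> 0" using assms le_less_trans[OF zero_le_cordinal] by blast
  ultimately show ?thesis using assms by (intro that[of "max y y\<^sub>0"]) auto
qed

lemma cb_rank_leI:
  assumes "y < x" "\<And>z. z \<in> A \<Longrightarrow> y < z \<Longrightarrow> z < x \<Longrightarrow> cb_rank A z < c"
  shows "cb_rank A x \<le> c"
  by (subst cb_rank.simps, rule Least_le) (use assms in auto)

lemma less_cb_rankD: "c < cb_rank A x \<Longrightarrow> y < x \<Longrightarrow> \<exists>z\<in>A. y < z \<and> z < x \<and> c \<le> cb_rank A z"
  using cb_rank_leI[of y x A c] by (meson not_le)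

lemma cb_rank_pos_limit:
  assumes "0 < cb_rank A x"
  shows "limit_ord x"
proof (cases x rule: ord_cases)
  case zero
  then have "cb_rank A x \<le> 0" by (subst cb_rank.simps) (rule Least_le, auto)
  then show ?thesis using assms by simp
next
  case (succ c)
  then show ?thesis using less_cb_rankD[OF assms, of c] osucc_less by (auto simp: less_osucc_iff)
qed

lemma le_cb_rankI:
  assumes "0 < x" "\<And>c y. c < d \<Longrightarrow> y < x \<Longrightarrow> \<exists>z\<in>A. y < z \<and> z < x \<and> c \<le> cb_rank A z"
  shows "d \<le> cb_rank A x"
proof (rule ccontr)
  assume "\<not> d \<le> cb_rank A x"
  moreover obtain y where "y < x" "\<And>z. z \<in> A \<Longrightarrow> y < z \<Longrightarrow> z < x \<Longrightarrow> cb_rank A z < cb_rank A x"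
    using cb_rank_witness[OF assms(1)] by blast
  ultimately show False using assms(2)[of "cb_rank A x" y] by (auto simp: not_le[symmetric])
qed

text \<open>Translation by $a$ is a homeomorphism from the positive ordinals onto the final segment
  above $a$, and the rank depends on a left neighbourhood only. It fails for $c = 0$, where $a$ may be
  a limit.\<close>

lemma cb_rank_translate: "0 < c \<Longrightarrow> cb_rank UNIV (a + c) = cb_rank UNIV c"
proof (induction c rule: less_induct)
  case (less c)
  obtain y where y: "y < c" "\<And>z. z \<in> UNIV \<Longrightarrow> y < z \<Longrightarrow> z < c \<Longrightarrow> cb_rank UNIV z < cb_rank UNIV c"
    using cb_rank_witness[OF less.prems] by blast
  have "cb_rank UNIV (a + c) \<le> cb_rank UNIV c"
  proof (rule cb_rank_leI)
    show "a + y < a + c" using y(1) add_strict_mono_right by blast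
    fix z assume z: "a + y < z" "z < a + c"
    then obtain d where d: "z = a + d"
      using exists_difference[of a z] le_add[of a y] by (metis less_imp_le order_trans)
    then have "y < d" "d < c" using z by (auto simp: add_less_iff)
    then show "cb_rank UNIV z < cb_rank UNIV c"
      using less.IH[of d] y(2)[of d] d by (metis UNIV_I le_less_trans zero_le_cordinal)
  qed
  moreover have "cb_rank UNIV c \<le> cb_rank UNIV (a + c)"
  proof (rule le_cb_rankI)
    show "0 < a + c" using less.prems add_strict_mono_right le_less_trans zero_le_cordinal by blast
    fix e y assume e: "e < cb_rank UNIV c" and y: "y < a + c"
    obtain y' where y': "y' < c" "y \<le> a + y'"
    proof (cases "a \<le> y")
      case True
      then show ?thesis using exists_difference[OF True] y that add_less_iff by (metis order_refl)
    next
      case False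
      then show ?thesis using that[of 0] less.prems by (simp add: add_0_cordinal)
    qed
    obtain z where z: "y' < z" "z < c" "e \<le> cb_rank UNIV z" using less_cb_rankD[OF e y'(1)] by blast
    have "0 < z" using z(1) le_less_trans zero_le_cordinal by blast
    then show "\<exists>z\<in>UNIV. y < z \<and> z < a + c \<and> e \<le> cb_rank UNIV z"
      using z y' less.IH[of z] add_strict_mono_right[of _ _ a]
      by (intro bexI[of _ "a + z"]) (auto intro: le_less_trans)
  qed
  ultimately show ?case by simp
qed

text \<open>Both halves go into one induction. Below $\omega^{s+1}$ a positive ordinal is
  $\omega^s n + y$ with $y < \omega^s$. By translation it has the rank of $y$ if $y > 0$, and
  that of $\omega^s$ otherwise.\<close>

lemma cb_rank_oexp: "(\<forall>b. 0 < b \<and> b < \<omega> \<up> t \<longrightarrow> cb_rank UNIV b < t) \<and> cb_rank UNIV (\<omega> \<up> t) = t"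
proof (induction t rule: less_induct)
  case (less t)
  have IH: "\<And>s b. s < t \<Longrightarrow> 0 < b \<Longrightarrow> b < \<omega> \<up> s \<Longrightarrow> cb_rank UNIV b < s"
    "\<And>s. s < t \<Longrightarrow> cb_rank UNIV (\<omega> \<up> s) = s"
    using less by blast+
  have below: "cb_rank UNIV b < t" if b: "0 < b" "b < \<omega> \<up> t" for b
  proof (cases t rule: ord_cases)
    case zero
    then show ?thesis using b
      by (simp add: oexp_0 one_cordinal_def less_osucc_iff)
  next
    case (succ s)
    have s: "s < t" using succ osucc_less by simp
    obtain n y where y: "b = \<omega> \<up> s * ord_of_nat n + y" "y < \<omega> \<up> s"
      using less_oexp_osucc b succ by metis
    have "cb_rank UNIV b \<le> s"
    proof (cases "y = 0")
      case True
      then obtain m where "n = Suc m" using b y by (cases n) (auto simp: mult_0_cordinal add_0_cordinal)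
      then have "b = \<omega> \<up> s * ord_of_nat m + \<omega> \<up> s" using True y by (simp add: mult_osucc add_0_cordinal)
      then show ?thesis using cb_rank_translate[OF zero_less_oexp] IH(2)[OF s] by simp
    next
      case False
      then show ?thesis
        using y IH(1)[OF s, of y] cb_rank_translate[of y] by (auto simp: zero_less_ord)
    qed
    then show ?thesis using s by simp
  next
    case limit
    then obtain s where "s < t" "b < \<omega> \<up> s" using b less_oexp_limit by blast
    then show ?thesis using IH(1)[of s b] b by auto
  qed
  have "t \<le> cb_rank UNIV (\<omega> \<up> t)"
  proof (rule le_cb_rankI[OF zero_less_oexp])
    fix c y assume c: "c < t" and y: "y < \<omega> \<up> t"
    show "\<exists>z\<in>UNIV. y < z \<and> z < \<omega> \<up> t \<and> c \<le> cb_rank UNIV z"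
    proof (cases t rule: ord_cases)
      case zero
      then show ?thesis using c by simp
    next
      case (succ s)
      have s: "s < t" "c \<le> s" using succ osucc_less c less_osucc_iff by auto
      obtain n where n: "y < \<omega> \<up> s * ord_of_nat n"
        using y unfolding succ oexp_osucc less_mult_omega_iff by blast
      let ?z = "\<omega> \<up> s * ord_of_nat (Suc n)"
      have "y < ?z" using n mult_nat_less[OF zero_less_oexp] less_trans by blast
      moreover have "?z < \<omega> \<up> t"
        unfolding succ oexp_osucc less_mult_omega_iff using mult_nat_less[OF zero_less_oexp] by blast
      moreover have "cb_rank UNIV ?z = s"
        using cb_rank_translate[OF zero_less_oexp] IH(2)[OF s(1)] by (simp add: mult_osucc)
      ultimately show ?thesis using s(2) by (intro bexI[of _ ?z]) simp_all
    next
      case limit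
      then obtain s where s: "s < t" "y < \<omega> \<up> s" using y less_oexp_limit by blast
      let ?s = "max s c"
      have "?s < t" using s c by simp
      moreover have "\<omega> \<up> s \<le> \<omega> \<up> ?s"
        using oexp_less[of s ?s] by (cases "s = ?s") (auto simp: less_le)
      ultimately show ?thesis
        using s IH(2)[of ?s] oexp_less[of ?s t]
        by (intro bexI[of _ "\<omega> \<up> ?s"]) (auto simp del: max_less_iff_conj)
    qed
  qed
  moreover have "cb_rank UNIV (\<omega> \<up> t) \<le> t"
    by (rule cb_rank_leI[OF zero_less_oexp]) (use below in auto)
  ultimately have "cb_rank UNIV (\<omega> \<up> t) = t" by simp
  then show ?case using below by blast
qed

lemma cb_rank_below_oexp: "0 < b \<Longrightarrow> b < \<omega> \<up> t \<Longrightarrow> cb_rank UNIV b < t"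
  and cb_rank_oexp_eq: "cb_rank UNIV (\<omega> \<up> t) = t"
  using cb_rank_oexp by blast+

section \<open>Natural sum and the pigeonhole principle for ranks\<close>

text \<open>The natural (Hessenberg) sum, given as the least function that is strictly increasing in each
  argument. Strict monotonicity is all that bounding the rank of a union takes, and minimality all that
  the upper bounds below take.\<close>

function natural_sum :: "cordinal \<Rightarrow> cordinal \<Rightarrow> cordinal" where
  "natural_sum a b =
    (LEAST c. (\<forall>a'\<in>{..<a}. natural_sum a' b < c) \<and> (\<forall>b'\<in>{..<b}. natural_sum a b' < c))"
  by auto
termination
proof (relation "{(x :: cordinal, y). x < y} <*lex*> {(x :: cordinal, y). x < y}")
  show "wf ({(x :: cordinal, y). x < y} <*lex*> {(x :: cordinal, y). x < y})"
    by (intro wf_lex_prod wellorder_class.wf)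
qed simp_all

declare natural_sum.simps [simp del]

lemma natural_sum_bound:
  "(\<forall>a'\<in>{..<a}. natural_sum a' b < natural_sum a b) \<and>
    (\<forall>b'\<in>{..<b}. natural_sum a b' < natural_sum a b)"
proof -
  have "countable ((\<lambda>a'. natural_sum a' b) ` {..<a} \<union> natural_sum a ` {..<b})"
    by (simp add: countable_lessThan_cordinal)
  from countable_strict_bound[OF this]
  obtain d where "\<forall>c \<in> (\<lambda>a'. natural_sum a' b) ` {..<a} \<union> natural_sum a ` {..<b}. c < d" ..
  then have "(\<forall>a'\<in>{..<a}. natural_sum a' b < d) \<and> (\<forall>b'\<in>{..<b}. natural_sum a b' < d)" by blast
  then show ?thesis by (subst (2 4) natural_sum.simps) (rule LeastI)
qed

lemma natural_sum_less_left: "a' < a \<Longrightarrow> natural_sum a' b < natural_sum a b"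
  and natural_sum_less_right: "b' < b \<Longrightarrow> natural_sum a b' < natural_sum a b"
  using natural_sum_bound by auto

lemma natural_sum_mono: "a' \<le> a \<Longrightarrow> b' \<le> b \<Longrightarrow> natural_sum a' b' \<le> natural_sum a b"
  using natural_sum_less_left[of a' a b'] natural_sum_less_right[of b' b a] by (metis le_less less_trans)

lemma natural_sum_leI:
  "(\<And>a'. a' < a \<Longrightarrow> natural_sum a' b < c) \<Longrightarrow>
    (\<And>b'. b' < b \<Longrightarrow> natural_sum a b' < c) \<Longrightarrow> natural_sum a b \<le> c"
  by (subst natural_sum.simps, rule Least_le) auto

text \<open>The pigeonhole principle. Near \<open>x\<close> neither relative rank exceeds that of \<open>x\<close>: points
  \<open>z\<close> of larger rank relative to \<open>A\<close> would bring with them points of \<open>A\<close> of rank at least that of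
  \<open>x\<close> arbitrarily close to \<open>x\<close>. At points of \<open>A\<close> the rank relative to \<open>A\<close> is strictly smaller, and the same holds for \<open>B\<close>,
  so at points of the union the natural sum is strictly smaller.\<close>

lemma cb_rank_Un_le: "cb_rank (A \<union> B) x \<le> natural_sum (cb_rank A x) (cb_rank B x)"
proof (induction x rule: less_induct)
  case (less x)
  show ?case
  proof (cases "x = 0")
    case True
    then have "cb_rank (A \<union> B) x = 0"
      using cb_rank_pos_limit[of "A \<union> B" x] by (auto simp: limit_ord_def zero_less_ord)
    then show ?thesis by simp
  next
    case False
    then have x: "0 < x" by (simp add: zero_less_ord)
    obtain y where y: "y < x" "\<And>z. z \<in> A \<Longrightarrow> y < z \<Longrightarrow> z < x \<Longrightarrow> cb_rank A z < cb_rank A x"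
      using cb_rank_witness[OF x] by blast
    obtain y' where y': "y \<le> y'" "y' < x" "\<And>z. z \<in> B \<Longrightarrow> y' < z \<Longrightarrow> z < x \<Longrightarrow> cb_rank B z < cb_rank B x"
      using cb_rank_witness[OF y(1)] by blast
    show ?thesis
    proof (rule cb_rank_leI[OF y'(2)])
      fix z assume z: "z \<in> A \<union> B" "y' < z" "z < x"
      have A: "cb_rank A z \<le> cb_rank A x"
        using less_cb_rankD[of "cb_rank A x" A z y'] y(2) y' z by (meson le_less_trans less_trans not_le)
      have B: "cb_rank B z \<le> cb_rank B x"
        using less_cb_rankD[of "cb_rank B x" B z y'] y' z by (meson less_trans not_le)
      have "natural_sum (cb_rank A z) (cb_rank B z) < natural_sum (cb_rank A x) (cb_rank B x)"
      proof (cases "z \<in> A")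
        case True
        then show ?thesis using y y' z B natural_sum_less_left natural_sum_mono
          by (metis le_less_trans order_refl)
      next
        case False
        then show ?thesis using y' z A natural_sum_less_right natural_sum_mono
          by (metis UnE le_less_trans order_refl)
      qed
      then show "cb_rank (A \<union> B) z < natural_sum (cb_rank A x) (cb_rank B x)"
        using less.IH[OF z(3)] by (rule le_less_trans[rotated])
    qed
  qed
qed

lemma block_less:
  assumes "\<omega> \<up> s * ord_of_nat n' + a' < \<omega> \<up> s * ord_of_nat n + a" "a < \<omega> \<up> s"
  shows "n' < n \<or> n' = n \<and> a' < a"
proof (rule ccontr)
  assume "\<not> ?thesis"
  then consider "Suc n \<le> n'" | "n' = n" "a \<le> a'"
    by (cases n n' rule: linorder_cases) (auto simp: not_less Suc_le_eq)
  then show False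
  proof cases
    case 1
    have "\<omega> \<up> s * ord_of_nat n + a < \<omega> \<up> s * ord_of_nat (Suc n)"
      unfolding mult_ord_of_nat_Suc by (rule add_strict_mono_right[OF assms(2)])
    also have "\<dots> \<le> \<omega> \<up> s * ord_of_nat n'" by (rule mult_nat_mono[OF 1])
    also have "\<dots> \<le> \<omega> \<up> s * ord_of_nat n' + a'" by (rule le_add)
    finally show False using assms(1) by simp
  next
    case 2
    then show False using assms(1) by (simp add: add_less_iff)
  qed
qed

lemma block_predecessor:
  assumes "u < \<omega> \<up> s * ord_of_nat n + a" "a < \<omega> \<up> s"
  obtains n' a' where "u = \<omega> \<up> s * ord_of_nat n' + a'" "a' < \<omega> \<up> s"
    "n' < n \<or> n' = n \<and> a' < a"
proof -
  have "u < \<omega> \<up> s * ord_of_nat (Suc n)"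
    using assms add_strict_mono_right unfolding mult_ord_of_nat_Suc by (metis less_trans)
  then have "u < \<omega> \<up> osucc s" unfolding oexp_osucc less_mult_omega_iff by blast
  then obtain n' a' where "u = \<omega> \<up> s * ord_of_nat n' + a'" "a' < \<omega> \<up> s"
    by (rule less_oexp_osucc)
  then show ?thesis using that assms block_less by metis
qed

text \<open>Coefficients of $\omega^s$ add up without carry, because remainders stay below $\omega^s$ under
  natural sums. That closure property is a premise here since it is proved by induction on $s$ with this
  lemma as its successor step.\<close>

lemma natural_sum_block:
  assumes closed: "\<And>a b. a < \<omega> \<up> s \<Longrightarrow> b < \<omega> \<up> s \<Longrightarrow> natural_sum a b < \<omega> \<up> s"
    and "a < \<omega> \<up> s" "b < \<omega> \<up> s"
  shows "natural_sum (\<omega> \<up> s * ord_of_nat n + a) (\<omega> \<up> s * ord_of_nat m + b)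
    \<le> \<omega> \<up> s * ord_of_nat (n + m) + natural_sum a b"
  using assms(2,3)
proof (induction "\<omega> \<up> s * ord_of_nat n + a" "\<omega> \<up> s * ord_of_nat m + b"
    arbitrary: n a m b rule: natural_sum.induct)
  case (1 n a m b)
  have carry: "\<omega> \<up> s * ord_of_nat l + natural_sum a' b' < \<omega> \<up> s * ord_of_nat (n + m) + natural_sum a b"
    if "l < n + m" "a' < \<omega> \<up> s" "b' < \<omega> \<up> s" for l a' b'
  proof -
    have "\<omega> \<up> s * ord_of_nat l + natural_sum a' b' < \<omega> \<up> s * ord_of_nat (Suc l)"
      unfolding mult_ord_of_nat_Suc using closed that by (intro add_strict_mono_right) auto
    also have "\<dots> \<le> \<omega> \<up> s * ord_of_nat (n + m)" using that by (intro mult_nat_mono) auto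
    also have "\<dots> \<le> \<omega> \<up> s * ord_of_nat (n + m) + natural_sum a b" by (rule le_add)
    finally show ?thesis .
  qed
  show ?case
  proof (rule natural_sum_leI)
    fix u assume u: "u < \<omega> \<up> s * ord_of_nat n + a"
    obtain n' a' where *: "u = \<omega> \<up> s * ord_of_nat n' + a'" "a' < \<omega> \<up> s"
      "n' < n \<or> n' = n \<and> a' < a"
      using block_predecessor[OF u 1(3)] .
    have "natural_sum u (\<omega> \<up> s * ord_of_nat m + b) \<le> \<omega> \<up> s * ord_of_nat (n' + m) + natural_sum a' b"
      using 1(1)[of n' a' m b] u * 1(4) by auto
    also have "\<dots> < \<omega> \<up> s * ord_of_nat (n + m) + natural_sum a b"
      using *(3)
    proof
      assume "n' < n"
      then show ?thesis using carry[of "n' + m" a' b] * 1 by simp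
    qed (auto simp: add_less_iff natural_sum_less_left)
    finally show "natural_sum u (\<omega> \<up> s * ord_of_nat m + b) < \<omega> \<up> s * ord_of_nat (n + m) + natural_sum a b" .
  next
    fix u assume u: "u < \<omega> \<up> s * ord_of_nat m + b"
    obtain m' b' where *: "u = \<omega> \<up> s * ord_of_nat m' + b'" "b' < \<omega> \<up> s"
      "m' < m \<or> m' = m \<and> b' < b"
      using block_predecessor[OF u 1(4)] .
    have "natural_sum (\<omega> \<up> s * ord_of_nat n + a) u \<le> \<omega> \<up> s * ord_of_nat (n + m') + natural_sum a b'"
      using 1(2)[of m' b' n a] u * 1(3) by auto
    also have "\<dots> < \<omega> \<up> s * ord_of_nat (n + m) + natural_sum a b"
      using *(3)
    proof
      assume "m' < m"
      then show ?thesis using carry[of "n + m'" a b'] * 1 by simp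
    qed (auto simp: add_less_iff natural_sum_less_right)
    finally show "natural_sum (\<omega> \<up> s * ord_of_nat n + a) u < \<omega> \<up> s * ord_of_nat (n + m) + natural_sum a b" .
  qed
qed

lemma natural_sum_less_oexp: "a < \<omega> \<up> s \<Longrightarrow> b < \<omega> \<up> s \<Longrightarrow> natural_sum a b < \<omega> \<up> s"
proof (induction s arbitrary: a b rule: less_induct)
  case (less s)
  show ?case
  proof (cases s rule: ord_cases)
    case zero
    then have "a = 0" "b = 0" using less.prems
      by (simp_all add: oexp_0 one_cordinal_def less_osucc_iff antisym)
    moreover have "natural_sum 0 0 \<le> 0" by (rule natural_sum_leI) auto
    ultimately show ?thesis using zero_less_oexp by (metis le_less_trans)
  next
    case (succ t)
    then have closed: "\<And>a b. a < \<omega> \<up> t \<Longrightarrow> b < \<omega> \<up> t \<Longrightarrow> natural_sum a b < \<omega> \<up> t"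
      using less.IH osucc_less by blast
    obtain n a' where a: "a = \<omega> \<up> t * ord_of_nat n + a'" "a' < \<omega> \<up> t"
      using less.prems less_oexp_osucc succ by blast
    obtain m b' where b: "b = \<omega> \<up> t * ord_of_nat m + b'" "b' < \<omega> \<up> t"
      using less.prems less_oexp_osucc succ by blast
    have "natural_sum a b \<le> \<omega> \<up> t * ord_of_nat (n + m) + natural_sum a' b'"
      unfolding a(1) b(1) by (rule natural_sum_block[OF closed a(2) b(2)])
    also have "\<dots> < \<omega> \<up> t * ord_of_nat (Suc (n + m))"
      unfolding mult_ord_of_nat_Suc by (intro add_strict_mono_right closed a b)
    finally show ?thesis unfolding succ oexp_osucc less_mult_omega_iff by blast
  next
    case limit
    then obtain t u where "t < s" "a < \<omega> \<up> t" "u < s" "b < \<omega> \<up> u"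
      using less.prems less_oexp_limit by blast
    moreover have "\<omega> \<up> t \<le> \<omega> \<up> max t u" "\<omega> \<up> u \<le> \<omega> \<up> max t u"
      using oexp_less by (auto simp: max_def not_le intro: less_imp_le)
        (metis le_less oexp_less)
    ultimately have "a < \<omega> \<up> max t u" "b < \<omega> \<up> max t u" "max t u < s" by auto
    then show ?thesis using less.IH oexp_less less_trans by blast
  qed
qed

lemma natural_sum_less_block:
  assumes "a < \<omega> \<up> s"
  shows "natural_sum a (\<omega> \<up> s * ord_of_nat m) < \<omega> \<up> s * ord_of_nat (Suc m)"
proof -
  have "natural_sum (\<omega> \<up> s * ord_of_nat 0 + a) (\<omega> \<up> s * ord_of_nat m + 0)
      \<le> \<omega> \<up> s * ord_of_nat (0 + m) + natural_sum a 0"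
    by (rule natural_sum_block) (auto simp: natural_sum_less_oexp assms zero_less_oexp)
  also have "\<dots> < \<omega> \<up> s * ord_of_nat (Suc m)"
    using natural_sum_less_oexp[OF assms zero_less_oexp] by (simp add: mult_osucc add_strict_mono_right)
  finally show ?thesis by (simp add: mult_0_cordinal add_0_cordinal zero_add_cordinal)
qed

section \<open>Normal functions into sets of large rank\<close>

text \<open>For the intervals \<open>D\<close> used here this says that \<open>f\<close> is strictly increasing and continuous on
  \<open>D\<close>, in a purely order-theoretic form that survives cutting and pasting of intervals.\<close>

definition normal_on :: "cordinal set \<Rightarrow> (cordinal \<Rightarrow> cordinal) \<Rightarrow> bool" where
  "normal_on D f \<longleftrightarrow> strict_mono_on D f \<and>
    (\<forall>\<xi>\<in>D. limit_ord \<xi> \<longrightarrow> (\<forall>c<f \<xi>. \<exists>\<eta>\<in>D. \<eta> < \<xi> \<and> c < f \<eta>))"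

lemma normal_onI:
  assumes "\<And>x y. x \<in> D \<Longrightarrow> y \<in> D \<Longrightarrow> x < y \<Longrightarrow> f x < f y"
    and "\<And>\<xi> c. \<xi> \<in> D \<Longrightarrow> limit_ord \<xi> \<Longrightarrow> c < f \<xi> \<Longrightarrow> \<exists>\<eta>\<in>D. \<eta> < \<xi> \<and> c < f \<eta>"
  shows "normal_on D f"
  using assms by (auto simp: normal_on_def strict_mono_on_def)

lemma normal_on_less: "normal_on D f \<Longrightarrow> x \<in> D \<Longrightarrow> y \<in> D \<Longrightarrow> x < y \<Longrightarrow> f x < f y"
  by (auto simp: normal_on_def strict_mono_on_def)

lemma normal_on_limit:
  "normal_on D f \<Longrightarrow> \<xi> \<in> D \<Longrightarrow> limit_ord \<xi> \<Longrightarrow> c < f \<xi> \<Longrightarrow> \<exists>\<eta>\<in>D. \<eta> < \<xi> \<and> c < f \<eta>"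
  by (auto simp: normal_on_def)

lemma normal_on_less_iff: "normal_on D f \<Longrightarrow> x \<in> D \<Longrightarrow> y \<in> D \<Longrightarrow> f x < f y \<longleftrightarrow> x < y"
  by (metis less_asym linorder_less_linear normal_on_less)

lemma normal_on_inj: "normal_on D f \<Longrightarrow> inj_on f D"
  by (metis inj_onI linorder_less_linear normal_on_less order_less_irrefl)

lemma limit_ord_above:
  assumes "limit_ord x" "y < x" shows "\<exists>z. y < z \<and> z < x"
  using limit_ord_osucc_less[OF assms] osucc_less by blast

lemma normal_on_glue:
  assumes f: "normal_on {a<..e} f" and g: "normal_on {e<..b} g" and "a \<le> e" "e \<le> b"
    and below: "\<And>x y. a < x \<Longrightarrow> x \<le> e \<Longrightarrow> e < y \<Longrightarrow> y \<le> b \<Longrightarrow> f x < g y"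
  shows "normal_on {a<..b} (\<lambda>x. if x \<le> e then f x else g x)"
proof (rule normal_onI)
  fix x y assume "x \<in> {a<..b}" "y \<in> {a<..b}" "x < y"
  then show "(if x \<le> e then f x else g x) < (if y \<le> e then f y else g y)"
    using normal_on_less[OF f, of x y] normal_on_less[OF g, of x y] below[of x y] by auto
next
  fix \<xi> c assume \<xi>: "\<xi> \<in> {a<..b}" "limit_ord \<xi>" and c: "c < (if \<xi> \<le> e then f \<xi> else g \<xi>)"
  show "\<exists>\<eta>\<in>{a<..b}. \<eta> < \<xi> \<and> c < (if \<eta> \<le> e then f \<eta> else g \<eta>)"
  proof (cases "\<xi> \<le> e")
    case True
    then show ?thesis using normal_on_limit[OF f, of \<xi> c] \<xi> c \<open>e \<le> b\<close> by force
  next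
    case False
    then have "\<xi> \<in> {e<..b}" "c < g \<xi>" using \<xi> c by (auto split: if_splits)
    then obtain \<eta> where "\<eta> \<in> {e<..b}" "\<eta> < \<xi>" "c < g \<eta>"
      using normal_on_limit[OF g _ \<xi>(2)] by blast
    then show ?thesis using \<open>a \<le> e\<close> by (intro bexI[of _ \<eta>]) auto
  qed
qed

lemma limit_ord_cofinal_sequence:
  assumes "limit_ord b" "a < b"
  obtains s :: "nat \<Rightarrow> cordinal" where "strict_mono s" "\<And>n. a < s n" "\<And>n. s n < b"
    "\<And>c. c < b \<Longrightarrow> \<exists>n. c < s n"
proof -
  have "{..<b} \<noteq> {}" using assms by auto
  then obtain e :: "nat \<Rightarrow> cordinal" where e: "{..<b} = range e"
    using countable_lessThan_cordinal[of b] by (metis uncountable_def)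
  define s where "s = rec_nat (osucc (max a (e 0))) (\<lambda>n x. osucc (max x (e (Suc n))))"
  have s0: "s 0 = osucc (max a (e 0))" and sS: "\<And>n. s (Suc n) = osucc (max (s n) (e (Suc n)))"
    by (simp_all add: s_def)
  have eb: "e n < b" for n using e by blast
  have sb: "s n < b" for n
    by (induction n) (auto simp: s0 sS intro!: limit_ord_osucc_less assms eb)
  have es: "e n < s n" for n by (cases n) (auto simp: s0 sS less_osucc_iff)
  have mono: "strict_mono s" by (rule strict_monoI_Suc) (simp add: sS less_osucc_iff)
  have "a < s 0" by (simp add: s0 less_osucc_iff)
  then have "a < s n" for n
    using mono by (metis le0 less_le_trans strict_mono_less_eq)
  then show ?thesis using that mono sb es e by (metis lessThan_iff rangeE)
qed

text \<open>The union of a chain of normal functions, closed off at the top by the supremum \<open>z\<close> of its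
  values.\<close>

lemma normal_on_limit_extension:
  fixes s :: "nat \<Rightarrow> cordinal"
  assumes s: "strict_mono s" "\<And>n. s n < b" "\<And>c. c < b \<Longrightarrow> \<exists>n. c < s n"
    and F: "\<And>n. normal_on {a<..s n} (F n)" "\<And>n x. a < x \<Longrightarrow> x \<le> s n \<Longrightarrow> F n x \<in> A \<and> F n x < z"
    and coh: "\<And>n x. a < x \<Longrightarrow> x \<le> s n \<Longrightarrow> F (Suc n) x = F n x"
    and cof: "\<And>c. c < z \<Longrightarrow> \<exists>n. a < s n \<and> c < F n (s n)"
  obtains f where "normal_on {a<..b} f" "f b = z" "\<And>x. a < x \<Longrightarrow> x < b \<Longrightarrow> f x \<in> A \<and> f x < z"
proof -
  define f where "f x = (if x = b then z else F (LEAST n. x \<le> s n) x)" for x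
  have coh': "F n x = F m x" if "a < x" "x \<le> s m" "m \<le> n" for n m x
    using that(3)
  proof (induction n rule: dec_induct)
    case (step n)
    then have "x \<le> s n" using that(2) s(1) by (meson order_trans strict_mono_less_eq)
    then show ?case using coh[OF that(1)] step by simp
  qed simp
  have fF: "f x = F n x" if "a < x" "x \<le> s n" for x n
  proof -
    let ?m = "LEAST n. x \<le> s n"
    have "x \<le> s ?m" "?m \<le> n" using that by (auto intro: LeastI Least_le)
    then have "F n x = F ?m x" by (rule coh'[OF that(1)])
    moreover have "x \<noteq> b" using that s(2) by (meson not_le)
    ultimately show ?thesis by (simp add: f_def)
  qed
  have below: "f x \<in> A \<and> f x < z" if "a < x" "x < b" for x
  proof -
    obtain n where "x < s n" using s(3) \<open>x < b\<close> by blast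
    then show ?thesis using F(2) fF that by (metis less_imp_le)
  qed
  have fb: "f b = z" by (simp add: f_def)
  have "normal_on {a<..b} f"
  proof (rule normal_onI)
    fix x y assume x: "x \<in> {a<..b}" "y \<in> {a<..b}" "x < y"
    show "f x < f y"
    proof (cases "y = b")
      case True
      then show ?thesis using x below fb by auto
    next
      case False
      then have "y < b" using x by (auto simp: le_less)
      then obtain n where "y < s n" using s(3) by blast
      then show ?thesis using x normal_on_less[OF F(1), of x n y] fF[of x n] fF[of y n] by auto
    qed
  next
    fix \<xi> c assume \<xi>: "\<xi> \<in> {a<..b}" "limit_ord \<xi>" "c < f \<xi>"
    show "\<exists>\<eta>\<in>{a<..b}. \<eta> < \<xi> \<and> c < f \<eta>"
    proof (cases "\<xi> = b")
      case True
      then obtain n where "a < s n" "c < F n (s n)" using cof \<xi> fb by auto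
      then show ?thesis using fF[of "s n" n] s(2)[of n] True by (intro bexI[of _ "s n"]) auto
    next
      case False
      then have "\<xi> < b" using \<xi> by (auto simp: le_less)
      then obtain n where n: "\<xi> < s n" using s(3) by blast
      then have "\<xi> \<in> {a<..s n}" "c < F n \<xi>" using \<xi> fF[of \<xi> n] by auto
      then obtain \<eta> where "\<eta> \<in> {a<..s n}" "\<eta> < \<xi>" "c < F n \<eta>"
        using normal_on_limit[OF F(1) _ \<xi>(2)] by blast
      then show ?thesis using \<xi> fF[of \<eta> n] by (intro bexI[of _ \<eta>]) auto
    qed
  qed
  then show ?thesis using that fb below by blast
qed

text \<open>The heart of the embedding. The interval \<open>{a<..b}\<close> looks like $\omega^r$ followed by its top,
  where $r$ is the rank of \<open>b\<close>. For limit \<open>b\<close> it is cut at a sequence cofinal in \<open>b\<close>, and the pieces,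
  all of whose points have rank less than $r$, are sent to successive places on the way to \<open>z\<close>. The
  premise \<open>below\<close>, which provides the pieces, is \<open>embed_below\<close> for smaller ordinals: the two
  statements are proved by one induction.\<close>

lemma embed_onto_aux:
  assumes below: "\<And>a e x y. \<lbrakk>e < b; a \<le> e; y < x; \<And>d. a < d \<Longrightarrow> d \<le> e \<Longrightarrow> cb_rank UNIV d < cb_rank A x\<rbrakk>
      \<Longrightarrow> \<exists>f. normal_on {a<..e} f \<and> f ` {a<..e} \<subseteq> A \<inter> {y<..<x}"
    and "a < b" "y < z" "z \<in> A" and rank_b: "cb_rank UNIV b \<le> cb_rank A z"
    and small: "\<And>d. a < d \<Longrightarrow> d < b \<Longrightarrow> cb_rank UNIV d < cb_rank UNIV b"
  shows "\<exists>f. normal_on {a<..b} f \<and> f ` {a<..b} \<subseteq> A \<inter> {y<..z} \<and> f b = z"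
proof (cases b rule: ord_cases)
  case zero
  then show ?thesis using \<open>a < b\<close> by simp
next
  case (succ e)
  then have e: "e < b" "a \<le> e" using osucc_less \<open>a < b\<close> less_osucc_iff by auto
  obtain f where f: "normal_on {a<..e} f" "f ` {a<..e} \<subseteq> A \<inter> {y<..<z}"
    using below[OF e \<open>y < z\<close>] small rank_b e by (meson le_less_trans less_le_trans)
  have eb: "x = b" if "e < x" "x \<le> b" for x
    using that succ by (simp add: antisym osucc_le_iff)
  have "normal_on {e<..b} (\<lambda>_. z)"
    by (rule normal_onI) (use eb succ in \<open>auto simp: limit_ord_def\<close>)
  then have "normal_on {a<..b} (\<lambda>x. if x \<le> e then f x else z)"
    using f e by (intro normal_on_glue) (auto simp: image_subset_iff)
  then show ?thesis
    using f e assms(3,4) by (intro exI[of _ "\<lambda>x. if x \<le> e then f x else z"])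
      (auto simp: image_subset_iff less_imp_le)
next
  case limit
  have "0 < cb_rank UNIV b"
  proof -
    obtain d where "a < d" "d < b" using limit_ord_above[OF limit \<open>a < b\<close>] by blast
    then show ?thesis using small le_less_trans zero_le_cordinal by blast
  qed
  then have lz: "limit_ord z" using rank_b cb_rank_pos_limit less_le_trans by blast
  obtain s :: "nat \<Rightarrow> cordinal" where s: "strict_mono s" "\<And>n. a < s n" "\<And>n. s n < b" "\<And>c. c < b \<Longrightarrow> \<exists>n. c < s n"
    by (rule limit_ord_cofinal_sequence[OF limit \<open>a < b\<close>]) blast
  obtain t :: "nat \<Rightarrow> cordinal" where t: "strict_mono t" "\<And>n. y < t n" "\<And>n. t n < z" "\<And>c. c < z \<Longrightarrow> \<exists>n. c < t n"
    by (rule limit_ord_cofinal_sequence[OF lz \<open>y < z\<close>]) blast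
  have step: "\<exists>f. normal_on {a'<..s n} f \<and> f ` {a'<..s n} \<subseteq> A \<inter> {y'<..<z}"
    if "a \<le> a'" "a' \<le> s n" "y' < z" for a' y' n
  proof (rule below[OF s(3) that(2,3)])
    fix d assume "a' < d" "d \<le> s n"
    then have "a < d" "d < b" using \<open>a \<le> a'\<close> s(3)[of n] by auto
    then show "cb_rank UNIV d < cb_rank A z" using small rank_b less_le_trans by blast
  qed
  define P where "P n F \<longleftrightarrow> normal_on {a<..s n} F \<and> F ` {a<..s n} \<subseteq> A \<inter> {y<..<z} \<and> t n < F (s n)"
    for n F
  have base: "\<exists>F. P 0 F"
    using step[of a 0 "t 0"] s(2)[of 0] t(2)[of 0] t(3)[of 0]
    by (fastforce simp: P_def image_subset_iff intro: less_trans)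
  have extend: "\<exists>G. P (Suc n) G \<and> (\<forall>x. a < x \<and> x \<le> s n \<longrightarrow> G x = F x)" if "P n F" for n F
  proof -
    have sn: "a < s n" "s n < s (Suc n)" using s by (auto simp: strict_mono_Suc_iff)
    define y' where "y' = max (t (Suc n)) (F (s n))"
    have F: "normal_on {a<..s n} F" "F ` {a<..s n} \<subseteq> A \<inter> {y<..<z}" using that by (auto simp: P_def)
    have y': "y' < z" "y < y'" using F(2) sn t(2,3) by (auto simp: y'_def image_subset_iff less_max_iff_disj)
    obtain g where g: "normal_on {s n<..s (Suc n)} g" "g ` {s n<..s (Suc n)} \<subseteq> A \<inter> {y'<..<z}"
      using step[OF less_imp_le[OF sn(1)] less_imp_le[OF sn(2)] y'(1)] by blast
    have Fy: "F x \<le> y'" if "a < x" "x \<le> s n" for x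
    proof -
      have "F x \<le> F (s n)"
        using that normal_on_less[OF F(1), of x "s n"] sn(1) by (cases "x = s n") (auto simp: le_less)
      then show ?thesis unfolding y'_def by (rule max.coboundedI2)
    qed
    have "normal_on {a<..s (Suc n)} (\<lambda>x. if x \<le> s n then F x else g x)"
    proof (rule normal_on_glue[OF F(1) g(1)])
      fix x w assume "a < x" "x \<le> s n" "s n < w" "w \<le> s (Suc n)"
      then have "F x \<le> y'" "y' < g w" using Fy g(2) by (auto simp: image_subset_iff)
      then show "F x < g w" by (rule le_less_trans)
    qed (use sn in auto)
    moreover have "g (s (Suc n)) > t (Suc n)"
    proof -
      have "g (s (Suc n)) > y'" using g(2) sn by (auto simp: image_subset_iff)
      then show ?thesis by (simp add: y'_def)
    qed
    moreover have "y < g x" if "s n < x" "x \<le> s (Suc n)" for x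
      using g(2) y' that by (auto simp: image_subset_iff intro: less_trans)
    ultimately have "P (Suc n) (\<lambda>x. if x \<le> s n then F x else g x)"
      using F g sn by (auto simp: P_def image_subset_iff)
    then show ?thesis by (intro exI[of _ "\<lambda>x. if x \<le> s n then F x else g x"]) auto
  qed
  have "\<exists>F. \<forall>n. P n (F n) \<and> (\<forall>x. a < x \<and> x \<le> s n \<longrightarrow> F (Suc n) x = F n x)"
    by (rule dependent_nat_choice[of P "\<lambda>n F G. \<forall>x. a < x \<and> x \<le> s n \<longrightarrow> G x = F x"])
      (use base extend in auto)
  then obtain F where F: "\<And>n. P n (F n)" "\<And>n x. a < x \<Longrightarrow> x \<le> s n \<Longrightarrow> F (Suc n) x = F n x"
    by auto
  obtain f where f: "normal_on {a<..b} f" "f b = z" "\<And>x. a < x \<Longrightarrow> x < b \<Longrightarrow> f x \<in> A \<inter> {y<..} \<and> f x < z"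
  proof (rule normal_on_limit_extension[of s b a F "A \<inter> {y<..}" z])
    show "normal_on {a<..s n} (F n)" for n using F(1) by (simp add: P_def)
    show "F n x \<in> A \<inter> {y<..} \<and> F n x < z" if "a < x" "x \<le> s n" for n x
      using F(1)[of n] that by (auto simp: P_def image_subset_iff)
    show "\<exists>n. a < s n \<and> c < F n (s n)" if "c < z" for c
      using t(4)[OF that] s(2) F(1) by (meson P_def less_trans)
  qed (use s F(2) in auto)
  have "f x \<in> A \<inter> {y<..z}" if "x \<in> {a<..b}" for x
    using that f(2) f(3)[of x] \<open>y < z\<close> \<open>z \<in> A\<close> by (cases "x = b") (auto simp: le_less)
  then show ?thesis using f by blast
qed

text \<open>Cut \<open>{a<..b}\<close> at a point \<open>e\<close> after which only \<open>b\<close> has its full rank. The part up to \<open>e\<close> is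
  placed first, which uses up only a bounded part of the points below \<open>x\<close>. Beyond it there is still a
  point of \<open>A\<close> of rank at least that of \<open>b\<close> to receive the rest.\<close>

lemma embed_below: "\<lbrakk>a \<le> b; y < x; \<And>d. a < d \<Longrightarrow> d \<le> b \<Longrightarrow> cb_rank UNIV d < cb_rank A x\<rbrakk>
      \<Longrightarrow> \<exists>f. normal_on {a<..b} f \<and> f ` {a<..b} \<subseteq> A \<inter> {y<..<x}"
proof (induction b arbitrary: a x y rule: less_induct)
  case (less b)
  show ?case
  proof (cases "a = b")
    case True
    then show ?thesis by (auto simp: normal_on_def strict_mono_on_def)
  next
    case False
    then have ab: "a < b" using less.prems(1) by simp
    obtain e where e: "a \<le> e" "e < b" "\<And>d. e < d \<Longrightarrow> d < b \<Longrightarrow> cb_rank UNIV d < cb_rank UNIV b"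
      using cb_rank_witness[OF ab, of UNIV] by (metis UNIV_I)
    obtain f where f: "normal_on {a<..e} f" "f ` {a<..e} \<subseteq> A \<inter> {y<..<x}"
      using less.IH[of e a y x] less.prems e by (auto simp: order.strict_implies_order dest: le_less_trans)
    define y' where "y' = (if a < e then f e else y)"
    have y': "y \<le> y'" "y' < x" using f(2) e(1) less.prems(2) by (auto simp: y'_def image_subset_iff less_imp_le)
    have fy': "f d \<le> y'" if "a < d" "d \<le> e" for d
      using that normal_on_less[OF f(1), of d e] by (cases "d = e") (auto simp: y'_def le_less)
    have "cb_rank UNIV b < cb_rank A x" using less.prems(3) ab by blast
    then obtain z where z: "z \<in> A" "y' < z" "z < x" "cb_rank UNIV b \<le> cb_rank A z"
      using less_cb_rankD y'(2) by blast
    obtain g where g: "normal_on {e<..b} g" "g ` {e<..b} \<subseteq> A \<inter> {y'<..z}"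
      using embed_onto_aux[OF _ e(2) z(2,1,4) e(3)] less.IH by blast
    have gy': "y' < g d" "g d < x" "g d \<in> A" if "e < d" "d \<le> b" for d
      using g(2) that z(3) by (auto simp: image_subset_iff intro: le_less_trans)
    have "normal_on {a<..b} (\<lambda>d. if d \<le> e then f d else g d)"
    proof (rule normal_on_glue[OF f(1) g(1) e(1) less_imp_le[OF e(2)]])
      show "f d < g d'" if "a < d" "d \<le> e" "e < d'" "d' \<le> b" for d d'
        using fy'[OF that(1,2)] gy'(1)[OF that(3,4)] by (rule le_less_trans)
    qed
    moreover have "(\<lambda>d. if d \<le> e then f d else g d) ` {a<..b} \<subseteq> A \<inter> {y<..<x}"
      using f(2) gy' y' by (auto simp: image_subset_iff intro: le_less_trans)
    ultimately show ?thesis by blast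
  qed
qed

lemma embed_onto:
  "\<lbrakk>a < b; y < z; z \<in> A; cb_rank UNIV b \<le> cb_rank A z; \<And>d. a < d \<Longrightarrow> d < b \<Longrightarrow> cb_rank UNIV d < cb_rank UNIV b\<rbrakk>
      \<Longrightarrow> \<exists>f. normal_on {a<..b} f \<and> f ` {a<..b} \<subseteq> A \<inter> {y<..z} \<and> f b = z"
  by (rule embed_onto_aux[OF embed_below])

text \<open>The half-open interval \<open>{0<..\<omega> \<up> t}\<close> is embedded first, and then $0$ is sent to a point of
  \<open>A\<close> below all other values. That point exists because $t > 0$ makes \<open>x\<close> a limit of points of \<open>A\<close>.\<close>

lemma embed_oexp:
  assumes "x \<in> A" "t \<le> cb_rank A x" "0 < t"
  obtains f where "normal_on {..\<omega> \<up> t} f" "f ` {..\<omega> \<up> t} \<subseteq> A" "f (\<omega> \<up> t) = x"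
proof -
  have "0 < cb_rank A x" using assms by simp
  moreover from this have "0 < x" using cb_rank_pos_limit zero_less_ord limit_ord_def by blast
  ultimately obtain w where w: "w \<in> A" "w < x" using less_cb_rankD by blast
  obtain f where f: "normal_on {0<..\<omega> \<up> t} f" "f ` {0<..\<omega> \<up> t} \<subseteq> A \<inter> {w<..x}" "f (\<omega> \<up> t) = x"
    using embed_onto[of 0 "\<omega> \<up> t" w x A] w assms cb_rank_oexp_eq cb_rank_below_oexp zero_less_oexp
    by (metis (no_types, lifting))
  have fw: "w < f d" "f d \<in> A" if "0 < d" "d \<le> \<omega> \<up> t" for d
    using f(2) that by (auto simp: image_subset_iff)
  define g where "g d = (if d = 0 then w else f d)" for d
  have "normal_on {..\<omega> \<up> t} g"
  proof (rule normal_onI)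
    show "g d < g e" if "d \<in> {..\<omega> \<up> t}" "e \<in> {..\<omega> \<up> t}" "d < e" for d e
      using that fw normal_on_less[OF f(1), of d e] by (auto simp: g_def zero_less_ord)
    fix \<xi> c assume "\<xi> \<in> {..\<omega> \<up> t}" "limit_ord \<xi>" "c < g \<xi>"
    then obtain \<eta> where "\<eta> \<in> {0<..\<omega> \<up> t}" "\<eta> < \<xi>" "c < f \<eta>"
      using normal_on_limit[OF f(1), of \<xi> c] by (auto simp: g_def limit_ord_def zero_less_ord)
    then show "\<exists>\<eta>\<in>{..\<omega> \<up> t}. \<eta> < \<xi> \<and> c < g \<eta>"
      by (intro bexI[of _ \<eta>]) (auto simp: g_def)
  qed
  moreover have "g ` {..\<omega> \<up> t} \<subseteq> A" using fw w by (auto simp: g_def zero_less_ord)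
  moreover have "g (\<omega> \<up> t) = x" using f(3) zero_less_oexp[of t] by (auto simp: g_def)
  ultimately show ?thesis using that by blast
qed

section \<open>Closed copies as ranges of normal functions\<close>

text \<open>Continuity matters at limit points only, and there it means having no jump. The inverse of a
  strictly increasing map from an ordinal is continuous for free, because initial and final segments
  pull back to traces of such segments.\<close>

lemma closed_copy_iff_normal: "closed_copy \<mu> X \<longleftrightarrow> (\<exists>f. normal_on {..<\<mu>} f \<and> f ` {..<\<mu>} = X)"
proof
  assume "closed_copy \<mu> X"
  then obtain h g where hom: "homeomorphism X {..<\<mu>} h g" and mono: "strict_mono_on X h"
    by (auto simp: closed_copy_def)
  have less: "g x < g y" if "x < \<mu>" "y < \<mu>" "x < y" for x y
  proof -
    have "g x \<in> X" "g y \<in> X" "h (g x) = x" "h (g y) = y"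
      using hom that by (auto simp: homeomorphism_def)
    then show ?thesis using mono \<open>x < y\<close>
      by (metis less_asym linorder_less_linear strict_mono_onD)
  qed
  have "normal_on {..<\<mu>} g"
  proof (rule normal_onI)
    fix \<xi> c assume \<xi>: "\<xi> \<in> {..<\<mu>}" "limit_ord \<xi>" "c < g \<xi>"
    have "continuous_on {..<\<mu>} g" using hom by (simp add: homeomorphism_def)
    then obtain U where U: "open U" "U \<inter> {..<\<mu>} = g -` {c<..} \<inter> {..<\<mu>}"
      by (metis continuous_on_open_invariant open_greaterThan)
    have "0 < \<xi>" using \<xi> by (simp add: limit_ord_def zero_less_ord)
    moreover have "\<xi> \<in> U" using U \<xi> by auto
    ultimately obtain b where b: "b < \<xi>" "{b<..\<xi>} \<subseteq> U" using open_left[OF U(1)] by blast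
    obtain \<eta> where \<eta>: "b < \<eta>" "\<eta> < \<xi>" using limit_ord_above[OF \<xi>(2) b(1)] by blast
    then have "\<eta> \<in> U \<inter> {..<\<mu>}" using b \<xi> by auto
    then show "\<exists>\<eta>\<in>{..<\<mu>}. \<eta> < \<xi> \<and> c < g \<eta>" using U \<eta> by auto
  qed (use less in auto)
  moreover have "g ` {..<\<mu>} = X" using hom by (simp add: homeomorphism_def)
  ultimately show "\<exists>f. normal_on {..<\<mu>} f \<and> f ` {..<\<mu>} = X" by blast
next
  assume "\<exists>f. normal_on {..<\<mu>} f \<and> f ` {..<\<mu>} = X"
  then obtain f where f: "normal_on {..<\<mu>} f" and X: "X = f ` {..<\<mu>}" by blast
  let ?h = "the_inv_into {..<\<mu>} f"
  have inj: "inj_on f {..<\<mu>}" by (rule normal_on_inj[OF f])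
  have h: "?h (f x) = x" if "x < \<mu>" for x
    using the_inv_into_f_f[OF inj] that by simp
  have mono: "f x < f y \<longleftrightarrow> x < y" if "x < \<mu>" "y < \<mu>" for x y
    using normal_on_less_iff[OF f] that by simp
  have "continuous_on {..<\<mu>} f"
    unfolding continuous_on_def
  proof
    fix \<xi> assume "\<xi> \<in> {..<\<mu>}"
    then have \<xi>: "\<xi> < \<mu>" by simp
    show "(f \<longlongrightarrow> f \<xi>) (at \<xi> within {..<\<mu>})"
    proof (rule order_tendstoI)
      fix c assume c: "c < f \<xi>"
      show "\<forall>\<^sub>F x in at \<xi> within {..<\<mu>}. c < f x"
      proof (cases "\<exists>\<eta><\<xi>. \<forall>x. \<eta> < x \<and> x < \<xi> \<longrightarrow> c < f x")
        case True
        then obtain \<eta> where \<eta>: "\<eta> < \<xi>" "\<And>x. \<eta> < x \<Longrightarrow> x < \<xi> \<Longrightarrow> c < f x" by blast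
        show ?thesis
          unfolding eventually_at_topological
          by (rule exI[of _ "{\<eta><..}"]) (use \<eta> c mono[OF \<xi>] in \<open>auto, metis less_trans linorder_neqE\<close>)
      next
        case False
        show ?thesis
        proof (cases \<xi> rule: ord_cases)
          case zero
          then show ?thesis
            unfolding eventually_at_topological
            by (intro exI[of _ UNIV]) (use c mono[OF \<xi>] in \<open>auto simp: zero_less_ord intro: less_trans\<close>)
        next
          case (succ e)
          then show ?thesis using False osucc_less less_osucc_iff by (meson not_le)
        next
          case limit
          then obtain \<eta> where "\<eta> \<in> {..<\<mu>}" "\<eta> < \<xi>" "c < f \<eta>" using normal_on_limit[OF f] \<xi> c by blast
          then show ?thesis using False mono \<xi> by (meson lessThan_iff less_trans)
        qed
      qed
    next
      fix c assume c: "f \<xi> < c"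
      have "f x < c" if "x < \<mu>" "x < osucc \<xi>" for x
        using that mono[OF _ \<xi>] c by (metis le_less less_osucc_iff less_trans)
      then show "\<forall>\<^sub>F x in at \<xi> within {..<\<mu>}. f x < c"
        unfolding eventually_at_topological
        by (intro exI[of _ "{..<osucc \<xi>}"]) (auto simp: osucc_less)
    qed
  qed
  moreover have "continuous_on X ?h"
    unfolding continuous_on_def X
  proof
    fix u assume "u \<in> f ` {..<\<mu>}"
    then obtain \<xi> where \<xi>: "u = f \<xi>" "\<xi> < \<mu>" by blast
    show "(?h \<longlongrightarrow> ?h u) (at u within f ` {..<\<mu>})"
    proof (rule order_tendstoI)
      fix c assume "c < ?h u"
      then have c: "c < \<xi>" using h \<xi> by simp
      then have "c < \<mu>" using \<xi> by simp
      then show "\<forall>\<^sub>F x in at u within f ` {..<\<mu>}. c < ?h x"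
        unfolding eventually_at_topological
        by (intro exI[of _ "{f c<..}"]) (use c h \<xi> mono in auto)
    next
      fix c assume "?h u < c"
      then have c: "\<xi> < c" using h \<xi> by simp
      show "\<forall>\<^sub>F x in at u within f ` {..<\<mu>}. ?h x < c"
      proof (cases "c < \<mu>")
        case True
        then show ?thesis
          unfolding eventually_at_topological
          by (intro exI[of _ "{..<f c}"]) (use c h \<xi> mono in auto)
      next
        case False
        then show ?thesis
          unfolding eventually_at_topological
          by (intro exI[of _ UNIV]) (use h in auto)
      qed
    qed
  qed
  moreover have "?h ` X = {..<\<mu>}" using h unfolding X by force
  moreover have "strict_mono_on X ?h"
    unfolding X by (intro strict_mono_onI) (use h mono in auto)
  ultimately show "closed_copy \<mu> X"
    unfolding closed_copy_def homeomorphism_def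
    by (intro exI[of _ ?h] exI[of _ f]) (use h X in auto)
qed

text \<open>A limit $\xi$ is sent by \<open>g\<close> to a limit, since a normal function approaches its value at a
  limit strictly from below. Hence the limit condition for \<open>f\<close> applies at $g(\xi)$.\<close>

lemma normal_on_comp:
  assumes f: "normal_on D f" and g: "normal_on {..<\<mu>} g" and sub: "g ` {..<\<mu>} \<subseteq> D"
  shows "normal_on {..<\<mu>} (f \<circ> g)"
proof (rule normal_onI)
  have gD: "g \<xi> \<in> D" if "\<xi> < \<mu>" for \<xi> using sub that by auto
  show "(f \<circ> g) x < (f \<circ> g) y" if "x \<in> {..<\<mu>}" "y \<in> {..<\<mu>}" "x < y" for x y
    using that normal_on_less[OF f] normal_on_less[OF g] gD by simp
  fix \<xi> c assume \<xi>: "\<xi> \<in> {..<\<mu>}" "limit_ord \<xi>" "c < (f \<circ> g) \<xi>"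
  have lim: "\<exists>\<eta><\<xi>. e < g \<eta>" if "e < g \<xi>" for e
    using normal_on_limit[OF g \<xi>(1,2) that] by blast
  have below: "g \<eta> < g \<xi>" if "\<eta> < \<xi>" for \<eta>
    using normal_on_less[OF g] that \<xi> by auto
  have "limit_ord (g \<xi>)"
  proof (cases "g \<xi>" rule: ord_cases)
    case zero
    then show ?thesis using below[of 0] \<xi>(2) by (auto simp: limit_ord_def zero_less_ord)
  next
    case (succ e)
    then obtain \<eta> where "\<eta> < \<xi>" "e < g \<eta>" using lim osucc_less by metis
    then show ?thesis using below succ by (metis less_osucc_iff not_le)
  qed
  then obtain e where e: "e \<in> D" "e < g \<xi>" "c < f e"
    using normal_on_limit[OF f, of "g \<xi>" c] gD \<xi> by auto
  then obtain \<eta> where \<eta>: "\<eta> < \<xi>" "e < g \<eta>" using lim by blast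
  then have "f e < f (g \<eta>)" using normal_on_less[OF f e(1) gD] \<xi> by auto
  then show "\<exists>\<eta>\<in>{..<\<mu>}. \<eta> < \<xi> \<and> c < (f \<circ> g) \<eta>"
    using e \<eta> \<xi> by (intro bexI[of _ \<eta>]) auto
qed

lemma closed_copy_image:
  assumes "normal_on D f" "closed_copy \<mu> X" "X \<subseteq> D"
  shows "closed_copy \<mu> (f ` X)"
  using assms normal_on_comp unfolding closed_copy_iff_normal by (metis image_comp)

text \<open>Cofinality of \<open>X\<close> in \<open>\<delta>\<close> gives continuity at the new top point.\<close>

lemma closed_copy_insert_top:
  assumes "closed_copy \<mu> X" "cofinal_in X \<delta>"
  shows "closed_copy (\<mu> + 1) (insert \<delta> X)"
proof -
  obtain g where g: "normal_on {..<\<mu>} g" and X: "X = g ` {..<\<mu>}"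
    using assms by (auto simp: closed_copy_iff_normal)
  have g\<delta>: "g \<xi> < \<delta>" if "\<xi> < \<mu>" for \<xi> using assms(2) that by (auto simp: X cofinal_in_def)
  define f where "f = g(\<mu> := \<delta>)"
  have dom: "{..<\<mu> + 1} = insert \<mu> {..<\<mu>}" by (auto simp: add_1_cordinal less_osucc_iff)
  have "normal_on {..<\<mu> + 1} f"
  proof (rule normal_onI)
    show "f x < f y" if "x \<in> {..<\<mu> + 1}" "y \<in> {..<\<mu> + 1}" "x < y" for x y
      using that g\<delta> normal_on_less[OF g, of x y] unfolding dom by (auto simp: f_def)
    fix \<xi> c assume \<xi>: "\<xi> \<in> {..<\<mu> + 1}" "limit_ord \<xi>" "c < f \<xi>"
    show "\<exists>\<eta>\<in>{..<\<mu> + 1}. \<eta> < \<xi> \<and> c < f \<eta>"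
    proof (cases "\<xi> = \<mu>")
      case True
      then have "c < \<delta>" using \<xi> by (simp add: f_def)
      then obtain \<eta> where \<eta>: "\<eta> < \<mu>" "c \<le> g \<eta>"
        using assms(2) by (auto simp: cofinal_in_def X)
      then have "osucc \<eta> < \<mu>" using limit_ord_osucc_less True \<xi> by blast
      moreover have "g \<eta> < g (osucc \<eta>)"
        using normal_on_less[OF g] \<eta> calculation osucc_less by simp
      ultimately show ?thesis
        using \<eta> True unfolding dom by (intro bexI[of _ "osucc \<eta>"]) (auto simp: f_def)
    next
      case False
      then have "\<xi> \<in> {..<\<mu>}" "c < g \<xi>" using \<xi> unfolding dom by (auto simp: f_def)
      then obtain \<eta> where "\<eta> \<in> {..<\<mu>}" "\<eta> < \<xi>" "c < g \<eta>" using normal_on_limit[OF g _ \<xi>(2)] by blast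
      then show ?thesis unfolding dom by (intro bexI[of _ \<eta>]) (auto simp: f_def)
    qed
  qed
  moreover have "f ` {..<\<mu> + 1} = insert \<delta> X" unfolding dom X f_def by auto
  ultimately show ?thesis unfolding closed_copy_iff_normal by blast
qed

section \<open>Homogeneous sets and the partition relation\<close>

lemma homogeneous_iff: "homogeneous c i X \<longleftrightarrow> (\<forall>x\<in>X. \<forall>y\<in>X. x \<noteq> y \<longrightarrow> c {x, y} = i)"
  unfolding homogeneous_def nsets_2_eq by auto

lemma homogeneous_image:
  assumes "homogeneous (\<lambda>e. c (f ` e)) i X" "inj_on f X"
  shows "homogeneous c i (f ` X)"
  using assms unfolding homogeneous_iff inj_on_def by fastforce

lemma homogeneous_insert:
  assumes "homogeneous c i X" "\<And>x. x \<in> X \<Longrightarrow> c {x, y} = i"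
  shows "homogeneous c i (insert y X)"
  using assms unfolding homogeneous_iff by (auto simp: insert_commute)

lemma homogeneous_subset: "homogeneous c i X \<Longrightarrow> Y \<subseteq> X \<Longrightarrow> homogeneous c i Y"
  unfolding homogeneous_iff by blast

lemma smaller_homogeneous_set:
  assumes "X \<in> [D]\<^bsup>q\<^esup>" "homogeneous c i X" "p \<le> q"
  shows "\<exists>X \<in> [D]\<^bsup>p\<^esup>. homogeneous c i X"
proof -
  have "p \<le> card X" using assms by (simp add: nsets_def)
  then obtain Y where "Y \<subseteq> X" "card Y = p" "finite Y"
    using obtain_subset_with_card_n by metis
  then show ?thesis using assms homogeneous_subset by (intro bexI[of _ Y]) (auto simp: nsets_def)
qed

text \<open>The hypothesis of the theorem for an arbitrary ordinal \<open>\<delta>\<close> and copies of \<open>\<mu>\<close>.\<close>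

definition cofinal_arrow :: "cordinal \<Rightarrow> cordinal \<Rightarrow> nat \<Rightarrow> bool" where
  "cofinal_arrow \<delta> \<mu> p \<longleftrightarrow> (\<forall>c :: cordinal set \<Rightarrow> color.
      (\<exists>X \<in> [{..<\<delta>}]\<^bsup>p\<^esup>. homogeneous c Blue X) \<or>
      (\<exists>X \<subseteq> {..<\<delta>}. closed_copy \<mu> X \<and> cofinal_in X \<delta> \<and> homogeneous c Red X) \<or>
      (\<exists>X \<subseteq> {..<\<delta>}. closed_copy (\<mu> + 1) X \<and> homogeneous c Red X))"

text \<open>The hypothesis is applied to the coloring pulled back along \<open>f\<close>. If it yields a cofinal red copy
  of \<open>\<mu>\<close>, the top point \<open>\<delta>\<close> is added before taking the image, which preserves redness because all
  values of \<open>f\<close> are red neighbours of \<open>f \<delta>\<close>.\<close>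

lemma arrow_from_normal_function:
  assumes dich: "cofinal_arrow \<delta> \<mu> q" and "p \<le> q"
    and f: "normal_on {..\<delta>} f" "f ` {..\<delta>} \<subseteq> D"
    and red: "\<And>x. x < \<delta> \<Longrightarrow> c {f x, f \<delta>} = Red"
  shows "(\<exists>X \<subseteq> D. closed_copy (\<mu> + 1) X \<and> homogeneous c Red X) \<or>
    (\<exists>X \<in> [D]\<^bsup>p\<^esup>. homogeneous c Blue X)"
proof -
  let ?d = "\<lambda>e. c (f ` e)"
  have inj: "inj_on f {..\<delta>}" by (rule normal_on_inj[OF f(1)])
  have copy: ?thesis if "X \<subseteq> {..\<delta>}" "closed_copy (\<mu> + 1) X" "homogeneous ?d Red X" for X
  proof -
    have "homogeneous c Red (f ` X)" using homogeneous_image that inj inj_on_subset by blast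
    moreover have "closed_copy (\<mu> + 1) (f ` X)" by (rule closed_copy_image[OF f(1) that(2,1)])
    moreover have "f ` X \<subseteq> D" using f(2) that(1) by blast
    ultimately show ?thesis by blast
  qed
  consider (blue) X where "X \<in> [{..<\<delta>}]\<^bsup>q\<^esup>" "homogeneous ?d Blue X"
    | (cofinal) X where "X \<subseteq> {..<\<delta>}" "closed_copy \<mu> X" "cofinal_in X \<delta>" "homogeneous ?d Red X"
    | (red) X where "X \<subseteq> {..<\<delta>}" "closed_copy (\<mu> + 1) X" "homogeneous ?d Red X"
    using dich[unfolded cofinal_arrow_def, THEN spec, of ?d] by blast
  then show ?thesis
  proof cases
    case blue
    have X: "X \<subseteq> {..<\<delta>}" using blue(1) by (simp add: nsets_def)
    then have X': "X \<subseteq> {..\<delta>}" by auto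
    have "homogeneous c Blue (f ` X)"
      using homogeneous_image[OF blue(2)] inj_on_subset[OF inj X'] by blast
    moreover have "f ` X \<in> [D]\<^bsup>q\<^esup>"
      using blue(1) X' f(2) inj_on_subset[OF inj X'] by (auto simp: nsets_def card_image)
    ultimately show ?thesis using smaller_homogeneous_set \<open>p \<le> q\<close> by blast
  next
    case cofinal
    have "homogeneous ?d Red (insert \<delta> X)"
      using cofinal(1,4) red by (intro homogeneous_insert) auto
    moreover have "insert \<delta> X \<subseteq> {..\<delta>}" using cofinal(1) by auto
    ultimately show ?thesis using copy closed_copy_insert_top[OF cofinal(2,3)] by blast
  next
    case red
    moreover have "X \<subseteq> {..\<delta>}" using red(1) by auto
    ultimately show ?thesis using copy by blast
  qed
qed

lemma atMost_lessThan_add_1: "{..<x + 1} = {..x :: cordinal}"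
  by (auto simp: add_1_cordinal less_osucc_iff)

text \<open>If the blue neighbourhood of the top point is thin, the pigeonhole principle for ranks forces
  rank at least \<open>\<kappa>\<close> relative to the complement, which then contains a normal image of \<open>{..\<omega> \<up> \<kappa>}\<close>
  leading up to the top point.\<close>

lemma thin_blue_neighbourhood:
  fixes c :: "cordinal set \<Rightarrow> color"
  assumes dich: "cofinal_arrow (\<omega> \<up> \<kappa>) \<mu> q" and "p \<le> q" and "0 < \<kappa>"
    and B: "B = {x. x < \<omega> \<up> \<tau> \<and> c {x, \<omega> \<up> \<tau>} = Blue}"
    and thin: "\<And>x. x \<in> B \<Longrightarrow> cb_rank B x < \<sigma>"
    and sum: "\<And>\<gamma>. \<gamma> < \<kappa> \<Longrightarrow> natural_sum \<gamma> \<sigma> < \<tau>"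
  shows "(\<exists>X \<subseteq> {..<\<omega> \<up> \<tau> + 1}. closed_copy (\<mu> + 1) X \<and> homogeneous c Red X) \<or>
    (\<exists>X \<in> [{..<\<omega> \<up> \<tau> + 1}]\<^bsup>p\<^esup>. homogeneous c Blue X)"
proof -
  let ?\<theta> = "\<omega> \<up> \<tau>"
  have "cb_rank B ?\<theta> \<le> \<sigma>" by (rule cb_rank_leI[OF zero_less_oexp]) (use thin in auto)
  have "\<kappa> \<le> cb_rank (- B) ?\<theta>"
  proof (rule ccontr)
    assume "\<not> \<kappa> \<le> cb_rank (- B) ?\<theta>"
    then have less: "cb_rank (- B) ?\<theta> < \<kappa>" by simp
    have "\<tau> = cb_rank (- B \<union> B) ?\<theta>" by (simp add: cb_rank_oexp_eq)
    also have "\<dots> \<le> natural_sum (cb_rank (- B) ?\<theta>) (cb_rank B ?\<theta>)" by (rule cb_rank_Un_le)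
    also have "\<dots> \<le> natural_sum (cb_rank (- B) ?\<theta>) \<sigma>" by (rule natural_sum_mono[OF order_refl \<open>cb_rank B ?\<theta> \<le> \<sigma>\<close>])
    also have "\<dots> < \<tau>" by (rule sum[OF less])
    finally show False by simp
  qed
  moreover have "?\<theta> \<in> - B" by (simp add: B)
  ultimately obtain f where f: "normal_on {..\<omega> \<up> \<kappa>} f" "f ` {..\<omega> \<up> \<kappa>} \<subseteq> - B" "f (\<omega> \<up> \<kappa>) = ?\<theta>"
    using embed_oexp \<open>0 < \<kappa>\<close> by blast
  have below: "f x < ?\<theta>" if "x < \<omega> \<up> \<kappa>" for x
    using normal_on_less[OF f(1), of x "\<omega> \<up> \<kappa>"] that f(3) by simp
  show ?thesis
  proof (rule arrow_from_normal_function[OF dich \<open>p \<le> q\<close> f(1)])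
    show "f ` {..\<omega> \<up> \<kappa>} \<subseteq> {..<?\<theta> + 1}"
      unfolding atMost_lessThan_add_1 using below f(3) by (auto simp: le_less)
    fix x assume "x < \<omega> \<up> \<kappa>"
    moreover from this have "f x \<in> - B" using f(2) by (auto simp: image_subset_iff)
    ultimately show "c {f x, f (\<omega> \<up> \<kappa>)} = Red"
      using below unfolding B f(3) by (cases "c {f x, ?\<theta>}") auto
  qed
qed

lemma arrow_base:
  assumes dich: "cofinal_arrow (\<omega> \<up> (\<omega> \<up> \<alpha>)) \<mu> q" and q: "2 \<le> q"
  shows "arrow_cl (\<omega> \<up> (\<omega> \<up> \<alpha> * ord_of_nat 1) + 1) (\<mu> + 1) 2"
  unfolding arrow_cl_def mult_ord_of_nat_1
proof
  fix c :: "cordinal set \<Rightarrow> color"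
  let ?\<theta> = "\<omega> \<up> (\<omega> \<up> \<alpha>)"
  define B where "B = {x. x < ?\<theta> \<and> c {x, ?\<theta>} = Blue}"
  show "(\<exists>X\<subseteq>{..<?\<theta> + 1}. closed_copy (\<mu> + 1) X \<and> homogeneous c Red X) \<or>
      (\<exists>X\<in>[{..<?\<theta> + 1}]\<^bsup>2\<^esup>. homogeneous c Blue X)"
  proof (cases "B = {}")
    case True
    show ?thesis
    proof (rule thin_blue_neighbourhood[OF dich q zero_less_oexp B_def, of 0])
      show "natural_sum \<gamma> 0 < \<omega> \<up> \<alpha>" if "\<gamma> < \<omega> \<up> \<alpha>" for \<gamma>
        using natural_sum_less_oexp[OF that zero_less_oexp] .
    qed (use True in auto)
  next
    case False
    then obtain x where x: "x < ?\<theta>" "c {x, ?\<theta>} = Blue" by (auto simp: B_def)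
    have "{x, ?\<theta>} \<in> [{..<?\<theta> + 1}]\<^bsup>2\<^esup>"
      using x(1) unfolding atMost_lessThan_add_1 nsets_def by auto
    moreover have "homogeneous c Blue {x, ?\<theta>}"
      using x(2) by (auto simp: homogeneous_iff insert_commute)
    ultimately show ?thesis by blast
  qed
qed

text \<open>A blue pair among the blue neighbours makes a blue triple with the top point, so a closed copy
  of $\omega^\beta + 1$ among them may be assumed red. Without such a copy the neighbourhood is
  thin, and $\beta < \omega^\alpha$ bounds the natural sums.\<close>

lemma arrow_base_strict:
  assumes dich: "cofinal_arrow (\<omega> \<up> (\<omega> \<up> \<alpha>)) (\<omega> \<up> \<beta>) q"
    and q: "3 \<le> q" and "0 < \<beta>" and \<beta>: "\<beta> < \<omega> \<up> \<alpha>"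
  shows "arrow_cl (\<omega> \<up> (\<omega> \<up> \<alpha> * ord_of_nat 1) + 1) (\<omega> \<up> \<beta> + 1) 3"
  unfolding arrow_cl_def mult_ord_of_nat_1
proof
  fix c :: "cordinal set \<Rightarrow> color"
  let ?\<theta> = "\<omega> \<up> (\<omega> \<up> \<alpha>)"
  define B where "B = {x. x < ?\<theta> \<and> c {x, ?\<theta>} = Blue}"
  show "(\<exists>X\<subseteq>{..<?\<theta> + 1}. closed_copy (\<omega> \<up> \<beta> + 1) X \<and> homogeneous c Red X) \<or>
      (\<exists>X\<in>[{..<?\<theta> + 1}]\<^bsup>3\<^esup>. homogeneous c Blue X)"
  proof (cases "\<exists>x\<in>B. \<beta> \<le> cb_rank B x")
    case False
    show ?thesis
    proof (rule thin_blue_neighbourhood[OF dich q zero_less_oexp B_def, of \<beta>])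
      show "natural_sum \<gamma> \<beta> < \<omega> \<up> \<alpha>" if "\<gamma> < \<omega> \<up> \<alpha>" for \<gamma>
        using natural_sum_less_oexp[OF that \<beta>] .
    qed (use False in auto)
  next
    case True
    then obtain x f where f: "normal_on {..\<omega> \<up> \<beta>} f" "f ` {..\<omega> \<up> \<beta>} \<subseteq> B"
      using embed_oexp \<open>0 < \<beta>\<close> by metis
    let ?X = "f ` {..\<omega> \<up> \<beta>}"
    have XB: "x < ?\<theta>" "c {x, ?\<theta>} = Blue" if "x \<in> ?X" for x using f(2) that by (auto simp: B_def)
    have copy: "closed_copy (\<omega> \<up> \<beta> + 1) ?X"
      unfolding closed_copy_iff_normal atMost_lessThan_add_1 using f(1) by blast
    show ?thesis
    proof (cases "homogeneous c Red ?X")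
      case True
      have "?X \<subseteq> {..<?\<theta> + 1}"
        using XB unfolding atMost_lessThan_add_1 by (meson atMost_iff less_imp_le subsetI)
      then show ?thesis using copy True by blast
    next
      case False
      then obtain x y where xy: "x \<in> ?X" "y \<in> ?X" "x \<noteq> y" "c {x, y} \<noteq> Red"
        unfolding homogeneous_iff by blast
      then have blue: "c {x, y} = Blue" by (cases "c {x, y}") auto
      have "{x, y, ?\<theta>} \<in> [{..<?\<theta> + 1}]\<^bsup>3\<^esup>"
        using XB[OF xy(1)] XB[OF xy(2)] xy(3) unfolding atMost_lessThan_add_1 nsets_def by auto
      moreover have "homogeneous c Blue {x, y, ?\<theta>}"
        using blue XB[OF xy(1)] XB[OF xy(2)] by (auto simp: homogeneous_iff insert_commute)
      ultimately show ?thesis by blast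
    qed
  qed
qed

text \<open>Either the blue neighbourhood contains a closed copy of the smaller ordinal, where a blue set
  gains the top point, or it is thin.\<close>

lemma arrow_step:
  assumes dich: "cofinal_arrow (\<omega> \<up> (\<omega> \<up> \<alpha>)) \<mu> q"
    and IH: "arrow_cl (\<omega> \<up> (\<omega> \<up> \<alpha> * ord_of_nat m) + 1) (\<mu> + 1) p"
    and "0 < m" and q: "Suc p \<le> q"
  shows "arrow_cl (\<omega> \<up> (\<omega> \<up> \<alpha> * ord_of_nat (Suc m)) + 1) (\<mu> + 1) (Suc p)"
  unfolding arrow_cl_def
proof
  fix c :: "cordinal set \<Rightarrow> color"
  let ?\<sigma> = "\<omega> \<up> \<alpha> * ord_of_nat m"
  let ?\<theta> = "\<omega> \<up> (\<omega> \<up> \<alpha> * ord_of_nat (Suc m))"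
  define B where "B = {x. x < ?\<theta> \<and> c {x, ?\<theta>} = Blue}"
  have "0 < ?\<sigma>" using \<open>0 < m\<close> mult_nat_less[OF zero_less_oexp, of \<alpha>]
    by (cases m) (auto intro: le_less_trans[OF zero_le_cordinal])
  show "(\<exists>X\<subseteq>{..<?\<theta> + 1}. closed_copy (\<mu> + 1) X \<and> homogeneous c Red X) \<or>
      (\<exists>X\<in>[{..<?\<theta> + 1}]\<^bsup>Suc p\<^esup>. homogeneous c Blue X)"
  proof (cases "\<exists>x\<in>B. ?\<sigma> \<le> cb_rank B x")
    case False
    show ?thesis
    proof (rule thin_blue_neighbourhood[OF dich q zero_less_oexp B_def, of ?\<sigma>])
      show "natural_sum \<gamma> ?\<sigma> < \<omega> \<up> \<alpha> * ord_of_nat (Suc m)" if "\<gamma> < \<omega> \<up> \<alpha>" for \<gamma>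
        by (rule natural_sum_less_block[OF that])
    qed (use False in auto)
  next
    case True
    then obtain f where f: "normal_on {..\<omega> \<up> ?\<sigma>} f" "f ` {..\<omega> \<up> ?\<sigma>} \<subseteq> B"
      using embed_oexp \<open>0 < ?\<sigma>\<close> by metis
    have inj: "inj_on f {..\<omega> \<up> ?\<sigma>}" by (rule normal_on_inj[OF f(1)])
    have XB: "f ` X \<subseteq> B" if "X \<subseteq> {..\<omega> \<up> ?\<sigma>}" for X using f(2) that by blast
    have B\<theta>: "B \<subseteq> {..<?\<theta> + 1}" unfolding atMost_lessThan_add_1 B_def by auto
    consider (red) X where "X \<subseteq> {..\<omega> \<up> ?\<sigma>}" "closed_copy (\<mu> + 1) X" "homogeneous (\<lambda>e. c (f ` e)) Red X"
      | (blue) X where "X \<in> [{..\<omega> \<up> ?\<sigma>}]\<^bsup>p\<^esup>" "homogeneous (\<lambda>e. c (f ` e)) Blue X"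
      using IH[unfolded arrow_cl_def atMost_lessThan_add_1, THEN spec, of "\<lambda>e. c (f ` e)"] by blast
    then show ?thesis
    proof cases
      case red
      have "closed_copy (\<mu> + 1) (f ` X)" by (rule closed_copy_image[OF f(1) red(2,1)])
      moreover have "homogeneous c Red (f ` X)"
        by (rule homogeneous_image[OF red(3) inj_on_subset[OF inj red(1)]])
      ultimately show ?thesis using XB[OF red(1)] B\<theta> by blast
    next
      case blue
      have X: "X \<subseteq> {..\<omega> \<up> ?\<sigma>}" "finite X" "card X = p" using blue(1) by (auto simp: nsets_def)
      have hom: "homogeneous c Blue (f ` X)"
        by (rule homogeneous_image[OF blue(2) inj_on_subset[OF inj X(1)]])
      have "homogeneous c Blue (insert ?\<theta> (f ` X))"
        using hom XB[OF X(1)] by (intro homogeneous_insert) (auto simp: B_def)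
      moreover have "?\<theta> \<notin> f ` X" using XB[OF X(1)] by (auto simp: B_def)
      then have "insert ?\<theta> (f ` X) \<in> [{..<?\<theta> + 1}]\<^bsup>Suc p\<^esup>"
        using X XB[OF X(1)] B\<theta> inj_on_subset[OF inj X(1)]
        by (auto simp: nsets_def card_image atMost_lessThan_add_1)
      ultimately show ?thesis by blast
    qed
  qed
qed

lemma arrow_iterate:
  assumes dich: "cofinal_arrow (\<omega> \<up> (\<omega> \<up> \<alpha>)) \<mu> q"
    and base: "arrow_cl (\<omega> \<up> (\<omega> \<up> \<alpha> * ord_of_nat 1) + 1) (\<mu> + 1) p"
    and q: "p + n \<le> q"
  shows "arrow_cl (\<omega> \<up> (\<omega> \<up> \<alpha> * ord_of_nat (Suc n)) + 1) (\<mu> + 1) (p + n)"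
  using q
proof (induction n)
  case 0
  then show ?case using base by simp
next
  case (Suc n)
  then show ?case using arrow_step[OF dich, of "Suc n" "p + n"] by simp
qed

theorem theorem9p1:
  fixes \<alpha> \<beta> :: cordinal and k :: nat
  assumes "\<beta> > 0" and "k > 0"
    and "\<And>c :: cordinal set \<Rightarrow> color.
      (\<exists>X \<in> [{..<\<omega> \<up> (\<omega> \<up> \<alpha>)}]\<^bsup>(k + 2)\<^esup>. homogeneous c Blue X) \<or>
      (\<exists>X \<subseteq> {..<\<omega> \<up> (\<omega> \<up> \<alpha>)}.
         closed_copy (\<omega> \<up> \<beta>) X \<and> cofinal_in X (\<omega> \<up> (\<omega> \<up> \<alpha>)) \<and> homogeneous c Red X) \<or>
      (\<exists>X \<subseteq> {..<\<omega> \<up> (\<omega> \<up> \<alpha>)}. closed_copy (\<omega> \<up> \<beta> + 1) X \<and> homogeneous c Red X)"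
  shows "arrow_cl (\<omega> \<up> (\<omega> \<up> \<alpha> * ord_of_nat (k + 1)) + 1) (\<omega> \<up> \<beta> + 1) (k + 2) \<and>
    (\<omega> \<up> (\<omega> \<up> \<alpha>) > \<omega> \<up> \<beta> \<longrightarrow>
      arrow_cl (\<omega> \<up> (\<omega> \<up> \<alpha> * ord_of_nat k) + 1) (\<omega> \<up> \<beta> + 1) (k + 2))"
proof (intro conjI impI)
  have dich: "cofinal_arrow (\<omega> \<up> (\<omega> \<up> \<alpha>)) (\<omega> \<up> \<beta>) (k + 2)"
    unfolding cofinal_arrow_def using assms(3) by blast
  show "arrow_cl (\<omega> \<up> (\<omega> \<up> \<alpha> * ord_of_nat (k + 1)) + 1) (\<omega> \<up> \<beta> + 1) (k + 2)"
    using arrow_iterate[OF dich arrow_base[OF dich], of k] by (simp add: add.commute)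
  assume "\<omega> \<up> \<beta> < \<omega> \<up> (\<omega> \<up> \<alpha>)"
  then have "\<beta> < \<omega> \<up> \<alpha>" using oexp_less by (metis less_asym linorder_less_linear)
  moreover obtain n where "k = Suc n" using \<open>k > 0\<close> by (cases k) auto
  ultimately show "arrow_cl (\<omega> \<up> (\<omega> \<up> \<alpha> * ord_of_nat k) + 1) (\<omega> \<up> \<beta> + 1) (k + 2)"
    using arrow_iterate[OF dich arrow_base_strict[OF dich _ \<open>\<beta> > 0\<close>], of n]
    by (simp add: add.commute eval_nat_numeral)
qed

end
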